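(* Let $v$ be a positive integer with $v\notin\{47,49,59\}$. Then every strongly admissible multiset of size $v-1$ with support $\{1,6,18\}$ is realizable.
   Context: $K_v$ is the complete graph on vertex set $\{0,\dots,v-1\}$; the length of an edge $\{u,w\}$ is $\min(|u-w|,v-|u-w|)$. A multiset $L$ of size $v-1$ is realizable if some Hamiltonian path in $K_v$ has multiset of edge lengths equal to $L$. The support $\mathrm{supp}(L)$ is the set of distinct elements of $L$. $L$ of size $v-1$ is strongly admissible if $\mathrm{supp}(L)\subseteq\{1,\dots,\lfloor v/2\rfloor\}$ and $\gcd(v,z)=1$ for every $z\in L$. *)

theory Defs
  imports "HOL-Library.Multiset"
begin

definition complete_edges :: "nat \<Rightarrow> nat set set" where
  "complete_edges v = {{u, w} | u w. u < v \<and> w < v \<and> u \<noteq> w}"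

text \<open>A Hamiltonian path is given by its sequence of vertices.\<close>

definition hamiltonian_path :: "'a set \<Rightarrow> 'a set set \<Rightarrow> 'a list \<Rightarrow> bool" where
  "hamiltonian_path V E p \<longleftrightarrow>
     distinct p \<and> set p = V \<and> successively (\<lambda>x y. {x, y} \<in> E) p"

text \<open>The difference is taken in the integers because subtraction on the naturals truncates;
  the second subtraction does not truncate for vertices below \<open>v\<close>.\<close>

definition edge_length :: "nat \<Rightarrow> nat \<Rightarrow> nat \<Rightarrow> nat" where
  "edge_length v u w = (let d = nat \<bar>int u - int w\<bar> in min d (v - d))"

definition path_lengths :: "nat \<Rightarrow> nat list \<Rightarrow> nat multiset" where
  "path_lengths v p = mset (map2 (edge_length v) p (tl p))"

text \<open>For positive \<open>v\<close>, \<open>realizable v L\<close> implies \<open>size L = v - 1\<close>.\<close>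

definition realizable :: "nat \<Rightarrow> nat multiset \<Rightarrow> bool" where
  "realizable v L \<longleftrightarrow>
     (\<exists>p. hamiltonian_path {0..<v} (complete_edges v) p \<and> path_lengths v p = L)"

definition strongly_admissible :: "nat \<Rightarrow> nat multiset \<Rightarrow> bool" where
  "strongly_admissible v L \<longleftrightarrow>
     size L = v - 1 \<and> set_mset L \<subseteq> {1..v div 2} \<and> (\<forall>z\<in>#L. gcd v z = 1)"

end

(*
  A path whose edges are 1^a 6^(b+c) and whose 6-edges form long runs is turned into one with
  lengths 1^a 6^b 18^c by replacing runs 6, ..., 6 by words in 6 and 18 that visit the same vertices;
  each run has to keep only two or three of its sixes. Zigzags through columns of vertices that are
  congruent modulo 6 provide such paths, so this settles all large b.

  For small b, a path may be stretched at a place where each of 18 consecutive vertices has exactly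
  one edge across: inserting 18 new vertices there subdivides these edges and adds 18 to the
  multiplicity of 18. A path from 0 that does not wrap around may be prefixed by further edges of
  length 1. Hence finitely many explicit paths suffice: for each small pair (a, b) one for every residue
  of v modulo 18 prime to 6, and for larger a one for every residue of c modulo 18.
*)
theory Submission
  imports Defs
begin

section \<open>Paths on the integers below v\<close>

text \<open>The obstacle is arithmetic modulo 3. Measured in units of 6, a run whose two remaining
  sixes connect the three residue classes modulo 3 must change class both times in the same
  direction, so its ends are not congruent modulo 3. Replacing all but two sixes therefore fails for
  runs of length divisible by 3, except at the end of the path, where the last vertex may move. So
  an inner run is charged three sixes and the last run two. With a edges of length 1 and
  \<open>a + 1\<close> runs this costs \<open>3 * a + 2\<close> sixes, with the six columns of a
  zigzag it costs 17; these are the bounds from which on b counts as large.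

  Stretching at 18 needs at least 36 vertices. A path that does not wrap around and has at least 18
  eighteens reaches this number as soon as \<open>a + b\<close> is at least 17, and for a from 6 on
  this is where explicit cyclic paths give way to paths from 0. Coprimality of v and 6 enters twice:
  6 has an inverse modulo v, and only six residues of v modulo 18 remain.\<close>

primrec along :: "('a \<Rightarrow> 'a \<Rightarrow> 'b) \<Rightarrow> 'a \<Rightarrow> 'a list \<Rightarrow> 'b list" where
  "along f u [] = []"
| "along f u (w # p) = f u w # along f w p"

lemma along_eq_map2: "along f u p = map2 f (u # p) p"
  by (induction p arbitrary: u) auto

lemma length_along [simp]: "length (along f u p) = length p"
  by (induction p arbitrary: u) auto

text \<open>Differences up to \<open>x\<close> are read directly, larger ones around the cycle. For \<open>v > 2 * x\<close> this
  agrees with \<^const>\<open>edge_length\<close> on lengths up to \<open>x\<close>; for smaller \<open>v\<close> it still describes paths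
  that do not wrap around.\<close>

definition span :: "int \<Rightarrow> int \<Rightarrow> int \<Rightarrow> int \<Rightarrow> nat" where
  "span x v u w = nat (if \<bar>u - w\<bar> \<le> x then \<bar>u - w\<bar> else v - \<bar>u - w\<bar>)"

text \<open>Covering \<open>{0..<v}\<close> with a list of v entries leaves no room for repetitions,
  so the length stands in for distinctness. Exchanges of parts of a path then only have to preserve
  the length and lose no vertex.\<close>

definition traces :: "int \<Rightarrow> int \<Rightarrow> int \<Rightarrow> int list \<Rightarrow> nat multiset \<Rightarrow> bool" where
  "traces x v u p M \<longleftrightarrow> set (u # p) = {0..<v} \<and> int (length p) + 1 = v \<and>
     mset (along (span x v) u p) = M"

definition unwrapped :: "int \<Rightarrow> int \<Rightarrow> int list \<Rightarrow> bool" where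
  "unwrapped x u p \<longleftrightarrow> list_all (\<lambda>d. d \<le> x) (along (\<lambda>u w. \<bar>u - w\<bar>) u p)"

lemma unwrapped_simps [simp]:
  "unwrapped x u []"
  "unwrapped x u (w # p) \<longleftrightarrow> \<bar>u - w\<bar> \<le> x \<and> unwrapped x w p"
  by (auto simp: unwrapped_def)

text \<open>The two ways around the cycle have lengths with sum v > 2 * x, so at most one of them is
  at most x, and that one is the minimum in \<open>edge_length\<close>. Positivity of the lengths
  excludes loops.\<close>

lemma along_edge_length:
  assumes "set (u # p) \<subseteq> {0..<v}" "2 * x < v"
    and "\<And>l. l \<in> set (along (span x v) u p) \<Longrightarrow> 0 < l \<and> int l \<le> x"
  shows "along (edge_length (nat v)) (nat u) (map nat p) = along (span x v) u p \<and>
    successively (\<lambda>y z. {y, z} \<in> complete_edges (nat v)) (nat u # map nat p)"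
  using assms
proof (induction p arbitrary: u)
  case Nil
  then show ?case by simp
next
  case (Cons w p)
  have uw: "0 \<le> u" "u < v" "0 \<le> w" "w < v"
    using Cons.prems(1) by auto
  have l: "0 < span x v u w" "int (span x v u w) \<le> x"
    using Cons.prems(3)[of "span x v u w"] by auto
  have ne: "u \<noteq> w"
    using l by (auto simp: span_def split: if_splits)
  have 1: "edge_length (nat v) (nat u) (nat w) = span x v u w"
    using uw l ne Cons.prems(2)
    by (auto simp: edge_length_def span_def Let_def min_def nat_diff_distrib split: if_splits)
  have 2: "{nat u, nat w} \<in> complete_edges (nat v)"
    using uw ne unfolding complete_edges_def by (intro CollectI exI[of _ "nat u"] exI[of _ "nat w"]) auto
  have "set (w # p) \<subseteq> {0..<v}"
    using Cons.prems(1) by auto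
  then show ?case
    using Cons.IH[of w] Cons.prems(2,3) 1 2 by auto
qed

lemma traces_realizable:
  assumes t: "traces x v u p M" and x: "2 * x < v" and M: "\<And>l. l \<in># M \<Longrightarrow> 0 < l \<and> int l \<le> x"
  shows "realizable (nat v) M"
proof -
  have S: "set (u # p) = {0..<v}" and len: "int (length p) + 1 = v"
    and lens: "mset (along (span x v) u p) = M"
    using t by (auto simp: traces_def)
  have "along (edge_length (nat v)) (nat u) (map nat p) = along (span x v) u p \<and>
    successively (\<lambda>y z. {y, z} \<in> complete_edges (nat v)) (nat u # map nat p)"
  proof (rule along_edge_length)
    show "0 < l \<and> int l \<le> x" if "l \<in> set (along (span x v) u p)" for l
      using M that lens by (metis set_mset_mset)
  qed (use S x in auto)
  then have E: "along (edge_length (nat v)) (nat u) (map nat p) = along (span x v) u p"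
    and succ: "successively (\<lambda>y z. {y, z} \<in> complete_edges (nat v)) (map nat (u # p))"
    by simp_all
  have set: "set (map nat (u # p)) = {0..<nat v}"
  proof -
    have "set (map nat (u # p)) = nat ` {0..<v}"
      by (simp only: set_map S)
    also have "\<dots> = {0..<nat v}"
      by (auto simp: image_iff intro!: bexI[of _ "int _"])
    finally show ?thesis .
  qed
  moreover have "distinct (map nat (u # p))"
    by (rule card_distinct) (use set len in simp)
  moreover have "path_lengths (nat v) (map nat (u # p)) = M"
    using E lens by (simp add: path_lengths_def along_eq_map2)
  ultimately show ?thesis
    using succ unfolding realizable_def hamiltonian_path_def by blast
qed

text \<open>The old vertices move up by one to make room for the new start 0, while v grows by one.
  The length of an edge that is read directly survives this; that of an edge around the cycle would
  not, hence \<open>unwrapped\<close>.\<close>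

lemma traces_Cons_0:
  assumes "traces x v 0 p M" "unwrapped x 0 p" "1 \<le> x"
  shows "traces x (v + 1) 0 (1 # map (\<lambda>y. y + 1) p) (add_mset 1 M)"
    and "unwrapped x 0 (1 # map (\<lambda>y. y + 1) p)"
proof -
  have *: "along (span x (v + 1)) (u + 1) (map (\<lambda>y. y + 1) p) = along (span x v) u p \<and>
      unwrapped x (u + 1) (map (\<lambda>y. y + 1) p)" if "unwrapped x u p" for u
    using that by (induction p arbitrary: u) (auto simp: span_def)
  have S: "set (0 # p) = {0..<v}"
    using assms by (auto simp: traces_def)
  have "set (0 # 1 # map (\<lambda>y. y + 1) p) = insert 0 ((\<lambda>y. y + 1) ` set (0 # p))"
    by auto
  also have "\<dots> = {0..<v + 1}"
  proof -
    have "y \<in> insert 0 ((\<lambda>y. y + 1) ` {0..<v})" if "0 \<le> y" "y < v + 1" for y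
      using that by (cases "y = 0") (auto intro!: image_eqI[of _ _ "y - 1"])
    moreover have "0 \<in> {0..<v}"
      using S by force
    ultimately show ?thesis unfolding S by auto
  qed
  finally show "traces x (v + 1) 0 (1 # map (\<lambda>y. y + 1) p) (add_mset 1 M)"
    using assms *[OF assms(2)] by (auto simp: traces_def span_def)
  show "unwrapped x 0 (1 # map (\<lambda>y. y + 1) p)"
    using *[OF assms(2)] assms(3) by simp
qed

section \<open>Growing a path\<close>

text \<open>An edge around the cycle may also have its ends on either side of x. The bound on the
  difference leaves it out: only edges that \<open>span\<close> reads directly are to be
  subdivided.\<close>

definition crosses :: "int \<Rightarrow> int \<Rightarrow> int \<Rightarrow> bool" where
  "crosses x u w \<longleftrightarrow> min u w < x \<and> x \<le> max u w \<and> \<bar>u - w\<bar> \<le> x"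

primrec crossings :: "int \<Rightarrow> int \<Rightarrow> int list \<Rightarrow> int list" where
  "crossings x u [] = []"
| "crossings x u (w # p) = (if crosses x u w then min u w # crossings x w p else crossings x w p)"

definition lift :: "int \<Rightarrow> int \<Rightarrow> int" where
  "lift x u = (if u < x then u else u + x)"

text \<open>The vertices from \<open>x\<close> on move up by \<open>x\<close>, and every edge from \<open>u < x\<close> to \<open>w \<ge> x\<close> is subdivided
  by the new vertex \<open>u + x\<close>, which leaves an edge of length \<open>x\<close> and one of the old length.\<close>

primrec grow :: "int \<Rightarrow> int \<Rightarrow> int list \<Rightarrow> int list" where
  "grow x u [] = []"
| "grow x u (w # p) = (if crosses x u w then (min u w + x) # lift x w # grow x w p
     else lift x w # grow x w p)"

lemma mset_grow:
  "mset (grow x u p) = image_mset (lift x) (mset p) + image_mset (\<lambda>y. y + x) (mset (crossings x u p))"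
  by (induction p arbitrary: u) auto

lemma unwrapped_grow:
  "0 \<le> x \<Longrightarrow> unwrapped x u p \<Longrightarrow> unwrapped x (lift x u) (grow x u p)"
  by (induction p arbitrary: u) (auto simp: crosses_def lift_def min_def max_def split: if_splits)

text \<open>Of the two halves of a subdivided edge, the one from u to u + x is now the crossing
  edge. It has the same lower end as before, so the place of growth stays intact and the process can
  be repeated.\<close>

lemma grow_lengths:
  assumes "set (u # p) \<subseteq> {0..<v}" "0 \<le> x" "2 * x \<le> v"
    and "\<And>l. l \<in> set (along (span x v) u p) \<Longrightarrow> int l \<le> x"
  shows "crossings x (lift x u) (grow x u p) = crossings x u p \<and>
    mset (along (span x (v + x)) (lift x u) (grow x u p)) =
      mset (along (span x v) u p) + replicate_mset (length (crossings x u p)) (nat x)"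
  using assms
proof (induction p arbitrary: u)
  case Nil
  then show ?case by simp
next
  case (Cons w p)
  have uw: "0 \<le> u" "u < v" "0 \<le> w" "w < v"
    using Cons.prems(1) by auto
  have l: "int (span x v u w) \<le> x"
    using Cons.prems(4) by auto
  have IH: "crossings x (lift x w) (grow x w p) = crossings x w p"
    "mset (along (span x (v + x)) (lift x w) (grow x w p)) =
      mset (along (span x v) w p) + replicate_mset (length (crossings x w p)) (nat x)"
    using Cons.IH[of w] Cons.prems by auto
  show ?case
  proof (cases "crosses x u w")
    case True
    show ?thesis
    proof (cases "u < x")
      case u: True
      then have "x \<le> w" "w - u \<le> x" using True by (auto simp: crosses_def)
      then have "lift x u = u" "lift x w = w + x" "min u w = u" "min u (u + x) = u"
        "crosses x u (u + x)" "\<not> crosses x (u + x) (w + x)"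
        "span x (v + x) u (u + x) = nat x" "span x (v + x) (u + x) (w + x) = span x v u w"
        using u uw Cons.prems(2) by (auto simp: crosses_def lift_def span_def)
      then show ?thesis
        using True IH by simp
    next
      case u: False
      then have "w < x" "u - w \<le> x" using True by (auto simp: crosses_def)
      then have "lift x u = u + x" "lift x w = w" "min u w = w" "min (w + x) w = w"
        "crosses x (w + x) w" "\<not> crosses x (u + x) (w + x)"
        "span x (v + x) (w + x) w = nat x" "span x (v + x) (u + x) (w + x) = span x v u w"
        using u uw Cons.prems(2) by (auto simp: crosses_def lift_def span_def)
      then show ?thesis
        using True IH by simp
    qed
  next
    case False
    \<comment> \<open>Either both ends move, or both stay, or the edge runs around the cycle. In the
      last case its difference is at least v - x, which is at least x, so exactly one end is moved
      and the difference grows by x together with v.\<close>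
    have "\<not> crosses x (lift x u) (lift x w) \<and> span x (v + x) (lift x u) (lift x w) = span x v u w"
      using False uw l Cons.prems(2,3)
      by (auto simp: crosses_def lift_def span_def min_def max_def split: if_splits)
    then show ?thesis using False IH by simp
  qed
qed

text \<open>\<open>crossings\<close> lists lower ends, so each of the vertices 0, ..., x - 1 has
  exactly one edge across. The new vertices y + x then fill the gap from x to 2 * x - 1 that
  \<open>lift\<close> opens, each once.\<close>

definition growable :: "int \<Rightarrow> int \<Rightarrow> int list \<Rightarrow> bool" where
  "growable x u p \<longleftrightarrow> mset (crossings x u p) = mset_set {0..<x}"

lemma traces_grow:
  assumes t: "traces x v u p M" and g: "growable x u p" and x: "0 \<le> x" "2 * x \<le> v"
    and M: "\<And>l. l \<in># M \<Longrightarrow> int l \<le> x"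
  shows "traces x (v + x) (lift x u) (grow x u p) (M + replicate_mset (nat x) (nat x))"
    and "growable x (lift x u) (grow x u p)"
proof -
  have S: "set (u # p) = {0..<v}" and len: "int (length p) + 1 = v"
    and lens: "mset (along (span x v) u p) = M"
    using t by (auto simp: traces_def)
  have C: "mset (crossings x u p) = mset_set {0..<x}"
    using g by (simp add: growable_def)
  then have lc: "length (crossings x u p) = nat x"
    by (metis card_atLeastLessThan_int diff_zero size_mset size_mset_set)
  have L: "crossings x (lift x u) (grow x u p) = crossings x u p \<and>
    mset (along (span x (v + x)) (lift x u) (grow x u p)) =
      mset (along (span x v) u p) + replicate_mset (length (crossings x u p)) (nat x)"
  proof (rule grow_lengths)
    show "int l \<le> x" if "l \<in> set (along (span x v) u p)" for l
      using that M lens by (metis set_mset_mset)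
  qed (use S x in auto)
  then show "growable x (lift x u) (grow x u p)"
    using g by (simp add: growable_def)
  have m: "mset (lift x u # grow x u p) =
      image_mset (lift x) (mset (u # p)) + image_mset (\<lambda>y. y + x) (mset_set {0..<x})"
    using mset_grow[of x u p] C by simp
  have "set (lift x u # grow x u p) = lift x ` set (u # p) \<union> (\<lambda>y. y + x) ` {0..<x}"
    using arg_cong[OF m, of set_mset] by auto
  also have "\<dots> = {0..<v + x}"
  proof -
    have "{0..<v + x} \<subseteq> lift x ` {0..<v} \<union> (\<lambda>y. y + x) ` {0..<x}"
    proof
      fix y assume y: "y \<in> {0..<v + x}"
      consider "y < x" | "x \<le> y" "y < 2 * x" | "2 * x \<le> y" by linarith
      then show "y \<in> lift x ` {0..<v} \<union> (\<lambda>y. y + x) ` {0..<x}"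
      proof cases
        case 1
        then show ?thesis using y x by (auto simp: lift_def intro!: image_eqI[of _ _ y])
      next
        case 2
        then show ?thesis using y by (auto intro!: image_eqI[of _ _ "y - x"])
      next
        case 3
        then show ?thesis using y x by (auto simp: lift_def intro!: image_eqI[of _ _ "y - x"])
      qed
    qed
    moreover have "lift x ` {0..<v} \<union> (\<lambda>y. y + x) ` {0..<x} \<subseteq> {0..<v + x}"
      using x by (auto simp: lift_def)
    ultimately show ?thesis unfolding S by (rule equalityI[rotated])
  qed
  finally have "set (lift x u # grow x u p) = {0..<v + x}" .
  moreover have "int (length (grow x u p)) + 1 = v + x"
  proof -
    have "length (grow x u p) = length p + nat x"
      using mset_grow[of x u p] lc by (metis size_mset size_union size_image_mset)
    then show ?thesis using len x by simp
  qed
  ultimately show "traces x (v + x) (lift x u) (grow x u p) (M + replicate_mset (nat x) (nat x))"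
    using L lens lc by (simp add: traces_def)
qed

text \<open>A start at 0 and the absence of wrapping are carried through the iteration because edges
  of length 1 may still have to be prefixed afterwards.\<close>

lemma traces_grow_iterate:
  assumes "traces x v u p M" "growable x u p" "0 \<le> x" "2 * x \<le> v"
    and "\<And>l. l \<in># M \<Longrightarrow> int l \<le> x"
  shows "\<exists>u' p'. traces x (v + int j * x) u' p' (M + replicate_mset (j * nat x) (nat x)) \<and>
    (u = 0 \<and> unwrapped x 0 p \<longrightarrow> u' = 0 \<and> unwrapped x 0 p')"
proof -
  have "\<exists>u' p'. traces x (v + int j * x) u' p' (M + replicate_mset (j * nat x) (nat x)) \<and>
    growable x u' p' \<and> (u = 0 \<and> unwrapped x 0 p \<longrightarrow> u' = 0 \<and> unwrapped x 0 p')"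
  proof (induction j)
    case 0
    then show ?case using assms by auto
  next
    case (Suc j)
    then obtain u' p' where
      t: "traces x (v + int j * x) u' p' (M + replicate_mset (j * nat x) (nat x))"
      and g: "growable x u' p'"
      and u: "u = 0 \<and> unwrapped x 0 p \<longrightarrow> u' = 0 \<and> unwrapped x 0 p'"
      by blast
    have le: "2 * x \<le> v + int j * x"
      using assms(3,4) by (simp add: add_increasing2)
    have M: "int l \<le> x" if "l \<in># M + replicate_mset (j * nat x) (nat x)" for l
      using that assms(3,5) by (auto simp: in_replicate_mset split: if_splits)
    have eq: "v + int j * x + x = v + int (Suc j) * x"
      by (simp add: algebra_simps)
    have eq': "M + replicate_mset (j * nat x) (nat x) + replicate_mset (nat x) (nat x) =
        M + replicate_mset (Suc j * nat x) (nat x)"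
      by (rule multiset_eqI) simp
    have u0: "u = 0 \<and> unwrapped x 0 p \<longrightarrow> lift x u' = 0 \<and> unwrapped x 0 (grow x u' p')"
    proof
      assume "u = 0 \<and> unwrapped x 0 p"
      then have "u' = 0" "unwrapped x 0 p'" using u by auto
      moreover from this have "lift x 0 = 0"
      proof (cases "x = 0")
        case False
        then show ?thesis using assms(3) by (simp add: lift_def)
      qed (simp add: lift_def)
      ultimately show "lift x u' = 0 \<and> unwrapped x 0 (grow x u' p')"
        using unwrapped_grow[OF assms(3), of 0 p'] by simp
    qed
    show ?case
      using traces_grow[OF t g assms(3) le M] u0 unfolding eq eq' by blast
  qed
  then show ?thesis by blast
qed

section \<open>Words\<close>

primrec walk :: "('a \<Rightarrow> 'b \<Rightarrow> 'a) \<Rightarrow> 'a \<Rightarrow> 'b list \<Rightarrow> 'a list" where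
  "walk f u [] = []"
| "walk f u (d # ds) = f u d # walk f (f u d) ds"

lemma length_walk [simp]: "length (walk f u ds) = length ds"
  by (induction ds arbitrary: u) auto

text \<open>Addition modulo v with one correction in place of a division; exact from a vertex below
  v for steps of absolute value at most v.\<close>

definition step :: "int \<Rightarrow> int \<Rightarrow> int \<Rightarrow> int" where
  "step v u d = (let y = u + d in if y < 0 then y + v else if y < v then y else y - v)"

lemma step_range: "0 \<le> u \<Longrightarrow> u < v \<Longrightarrow> \<bar>d\<bar> \<le> v \<Longrightarrow> 0 \<le> step v u d \<and> step v u d < v"
  by (auto simp: step_def Let_def)

lemma step_eq_mod: "0 \<le> u \<Longrightarrow> u < v \<Longrightarrow> \<bar>d\<bar> \<le> v \<Longrightarrow> step v u d = (u + d) mod v"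
proof -
  assume u: "0 \<le> u" "u < v" "\<bar>d\<bar> \<le> v"
  then have "step v u d mod v = step v u d"
    using step_range by (intro mod_pos_pos_trivial) auto
  moreover have "step v u d mod v = (u + d) mod v"
    by (auto simp: step_def Let_def)
  ultimately show ?thesis by simp
qed

text \<open>Whether a word covers all residues can thus be decided for the walk on the integers,
  with a single reduction modulo v at the end.\<close>

lemma walk_step_mod:
  assumes "0 < v" "\<And>d. d \<in> set ds \<Longrightarrow> \<bar>d\<bar> \<le> v"
  shows "walk (step v) (s mod v) ds = map (\<lambda>y. y mod v) (walk (+) s ds)"
  using assms
proof (induction ds arbitrary: s)
  case (Cons d ds)
  have "step v (s mod v) d = (s + d) mod v"
    using Cons.prems by (simp add: step_eq_mod mod_simps)
  then show ?case using Cons by simp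
qed simp

abbreviation sizes :: "int list \<Rightarrow> nat multiset" where
  "sizes ds \<equiv> mset (map (\<lambda>d. nat \<bar>d\<bar>) ds)"

lemma along_walk_step:
  assumes "0 \<le> u" "u < v" "2 * x < v" "0 \<le> x" "\<And>d. d \<in> set ds \<Longrightarrow> \<bar>d\<bar> \<le> x"
  shows "along (span x v) u (walk (step v) u ds) = map (\<lambda>d. nat \<bar>d\<bar>) ds"
  using assms
proof (induction ds arbitrary: u)
  case (Cons d ds)
  have "\<bar>d\<bar> \<le> x" using Cons.prems by simp
  then have "span x v u (step v u d) = nat \<bar>d\<bar>" and "0 \<le> step v u d \<and> step v u d < v"
    using Cons.prems(1-4) by (auto simp: span_def step_def Let_def)
  then show ?case using Cons by simp
qed simp

lemma along_walk_plus:
  assumes "\<And>d. d \<in> set ds \<Longrightarrow> \<bar>d\<bar> \<le> x"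
  shows "along (span x v) u (walk (+) u ds) = map (\<lambda>d. nat \<bar>d\<bar>) ds \<and> unwrapped x u (walk (+) u ds)"
  using assms by (induction ds arbitrary: u) (auto simp: span_def)

text \<open>Vertices are integers here, not residues, so that exchanges of factors can be judged
  without reference to v.\<close>

definition visited :: "int \<Rightarrow> int list \<Rightarrow> int set" where
  "visited u ds = set (u # walk (+) u ds)"

lemma visited_Nil [simp]: "visited u [] = {u}"
  and visited_Cons [simp]: "visited u (d # ds) = insert u (visited (u + d) ds)"
  by (auto simp: visited_def)

lemma start_in_visited [simp]: "u \<in> visited u ds"
  by (simp add: visited_def)

lemma visited_append [simp]:
  "visited u (ds @ es) = visited u ds \<union> visited (u + sum_list ds) es"
proof (induction ds arbitrary: u)
  case Nil
  then show ?case using start_in_visited[of u es] by auto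
next
  case (Cons d ds)
  then show ?case by (simp add: add.assoc)
qed

lemma visited_shift: "visited (u + t) ds = (\<lambda>y. y + t) ` visited u ds"
proof (induction ds arbitrary: u)
  case (Cons d ds)
  have "visited (u + t) (d # ds) = insert (u + t) (visited (u + d + t) ds)"
    by (simp add: ac_simps)
  then show ?case unfolding Cons.IH[of "u + d"] by simp
qed simp

lemma visited_replicate: "visited u (replicate n d) = (\<lambda>i. u + int i * d) ` {..n}"
proof (induction n arbitrary: u)
  case (Suc n)
  show ?case by (simp add: Suc atMost_Suc_eq_insert_0 image_image algebra_simps)
qed simp

lemma visited_replicate_iff:
  "y \<in> visited u (replicate n d) \<longleftrightarrow> (\<exists>i. 0 \<le> i \<and> i \<le> int n \<and> y = u + i * d)"
proof
  assume "y \<in> visited u (replicate n d)"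
  then obtain i where "i \<le> n" "y = u + int i * d" by (auto simp: visited_replicate)
  then show "\<exists>i. 0 \<le> i \<and> i \<le> int n \<and> y = u + i * d" by (intro exI[of _ "int i"]) simp
next
  assume "\<exists>i. 0 \<le> i \<and> i \<le> int n \<and> y = u + i * d"
  then obtain i where "0 \<le> i" "i \<le> int n" "y = u + i * d" by blast
  then show "y \<in> visited u (replicate n d)"
    by (auto simp: visited_replicate intro!: image_eqI[of _ _ "nat i"])
qed

lemma sum_list_map_uminus: "sum_list (map uminus ds) = - sum_list (ds :: int list)"
  by (induction ds) auto

lemma visited_map_uminus: "visited (- u) (map uminus ds) = uminus ` visited u ds"
proof (induction ds arbitrary: u)
  case (Cons d ds)
  have "- u + - d = - (u + d)" by simp
  then show ?case by (simp only: list.map visited_Cons image_insert Cons.IH)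
qed simp

section \<open>Trading sixes for eighteens\<close>

text \<open>A factor of a word may be exchanged for one with the same length, the same sum and at least
  the same visited vertices; at the end of a word the sum is irrelevant.\<close>

definition trades :: "int list \<Rightarrow> nat \<Rightarrow> bool" where
  "trades ds c \<longleftrightarrow> (\<exists>es. length es = length ds \<and> sum_list es = sum_list ds \<and>
     visited 0 ds \<subseteq> visited 0 es \<and>
     sizes es + replicate_mset c 6 = sizes ds + replicate_mset c 18)"

definition end_trades :: "int list \<Rightarrow> nat \<Rightarrow> bool" where
  "end_trades ds c \<longleftrightarrow> (\<exists>es. length es = length ds \<and> visited 0 ds \<subseteq> visited 0 es \<and>
     sizes es + replicate_mset c 6 = sizes ds + replicate_mset c 18)"

lemma trades_imp_end_trades: "trades ds c \<Longrightarrow> end_trades ds c"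
  unfolding trades_def end_trades_def by blast

lemma trades_0 [simp]: "trades ds 0"
  by (auto simp: trades_def)

lemma visited_mono:
  assumes "visited 0 ds \<subseteq> visited 0 es" shows "visited u ds \<subseteq> visited u es"
proof -
  have *: "visited u fs = (\<lambda>y. y + u) ` visited 0 fs" for fs
    using visited_shift[of 0 u fs] by simp
  show ?thesis
    unfolding *[of ds] *[of es] using assms by (rule image_mono)
qed

lemma trade_sizes_append:
  assumes "sizes ds' + replicate_mset c 6 = sizes ds + replicate_mset c 18"
    and "sizes es' + replicate_mset d 6 = sizes es + replicate_mset d 18"
  shows "sizes (ds' @ es') + replicate_mset (c + d) 6 = sizes (ds @ es) + replicate_mset (c + d) 18"
proof -
  have r: "replicate_mset (c + d) y = replicate_mset c y + replicate_mset d y" for y :: nat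
    by (rule multiset_eqI) simp
  have "sizes (ds' @ es') + replicate_mset (c + d) 6 =
      (sizes ds' + replicate_mset c 6) + (sizes es' + replicate_mset d 6)"
    by (simp add: r ac_simps)
  also have "\<dots> = sizes (ds @ es) + replicate_mset (c + d) 18"
    unfolding assms by (simp add: r ac_simps)
  finally show ?thesis .
qed

text \<open>Equal sums make the second factor start at the same vertex as before, so its vertices
  are not displaced.\<close>

lemma trades_append:
  assumes "trades ds c" "trades es d" shows "trades (ds @ es) (c + d)"
proof -
  from assms obtain ds' es' where
    "length ds' = length ds" "sum_list ds' = sum_list ds" "visited 0 ds \<subseteq> visited 0 ds'"
    "sizes ds' + replicate_mset c 6 = sizes ds + replicate_mset c 18"
    "length es' = length es" "sum_list es' = sum_list es" "visited 0 es \<subseteq> visited 0 es'"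
    "sizes es' + replicate_mset d 6 = sizes es + replicate_mset d 18"
    unfolding trades_def by metis
  then show ?thesis
    using visited_mono[of es es' "sum_list ds"] trade_sizes_append[of ds' c ds es' d es]
    unfolding trades_def by (intro exI[of _ "ds' @ es'"]) auto
qed

lemma end_trades_append:
  assumes "trades ds c" "end_trades es d" shows "end_trades (ds @ es) (c + d)"
proof -
  from assms obtain ds' es' where
    "length ds' = length ds" "sum_list ds' = sum_list ds" "visited 0 ds \<subseteq> visited 0 ds'"
    "sizes ds' + replicate_mset c 6 = sizes ds + replicate_mset c 18"
    "length es' = length es" "visited 0 es \<subseteq> visited 0 es'"
    "sizes es' + replicate_mset d 6 = sizes es + replicate_mset d 18"
    unfolding trades_def end_trades_def by metis
  then show ?thesis
    using visited_mono[of es es' "sum_list ds"] trade_sizes_append[of ds' c ds es' d es]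
    unfolding end_trades_def by (intro exI[of _ "ds' @ es'"]) auto
qed

lemma sizes_map_uminus [simp]: "sizes (map uminus ds) = sizes ds"
  by (simp add: comp_def)

lemma trades_map_uminus:
  assumes "trades ds c" shows "trades (map uminus ds) c"
proof -
  from assms obtain es where "length es = length ds" "sum_list es = sum_list ds"
    "visited 0 ds \<subseteq> visited 0 es" "sizes es + replicate_mset c 6 = sizes ds + replicate_mset c 18"
    unfolding trades_def by metis
  then show ?thesis
    using visited_map_uminus[of 0 ds] visited_map_uminus[of 0 es]
    unfolding trades_def by (intro exI[of _ "map uminus es"]) (auto simp: sum_list_map_uminus comp_def)
qed

lemma end_trades_map_uminus:
  assumes "end_trades ds c" shows "end_trades (map uminus ds) c"
proof -
  from assms obtain es where "length es = length ds"
    "visited 0 ds \<subseteq> visited 0 es" "sizes es + replicate_mset c 6 = sizes ds + replicate_mset c 18"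
    unfolding end_trades_def by metis
  then show ?thesis
    using visited_map_uminus[of 0 ds] visited_map_uminus[of 0 es]
    unfolding end_trades_def by (intro exI[of _ "map uminus es"]) (auto simp: comp_def)
qed

text \<open>In units of 6, the three residue classes modulo 3 are traversed one after the other
  in steps of 3, upwards, downwards and upwards.\<close>

lemma trades_run_up: "trades (replicate (3 * k + 2) 6) (3 * k)"
proof -
  let ?es = "replicate k (18::int) @ 6 # replicate k (-18) @ 6 # replicate k 18"
  have "y \<in> visited 0 ?es" if y: "y \<in> visited 0 (replicate (3 * k + 2) 6)" for y
  proof -
    obtain i where i: "0 \<le> i" "i \<le> int (3 * k + 2)" "y = i * 6"
      using y unfolding visited_replicate_iff by auto
    have "i = 3 * (i div 3) \<or> i = 3 * (i div 3) + 1 \<or> i = 3 * (i div 3) + 2"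
      by presburger
    then consider j where "i = 3 * j" | j where "i = 3 * j + 1" | j where "i = 3 * j + 2"
      by blast
    then show ?thesis
    proof cases
      case 1
      then have "y \<in> visited 0 (replicate k 18)"
        unfolding visited_replicate_iff using i by (intro exI[of _ j]) auto
      then show ?thesis by simp
    next
      case 2
      then have "y \<in> visited (int k * 18 + 6) (replicate k (-18))"
        unfolding visited_replicate_iff using i by (intro exI[of _ "int k - j"]) auto
      then show ?thesis by (simp add: sum_list_replicate)
    next
      case 3
      then have "y \<in> visited 12 (replicate k 18)"
        unfolding visited_replicate_iff using i by (intro exI[of _ j]) auto
      then show ?thesis by (simp add: sum_list_replicate)
    qed
  qed
  moreover have "sizes ?es + replicate_mset (3 * k) 6 =
      sizes (replicate (3 * k + 2) (6::int)) + replicate_mset (3 * k) 18"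
    by (rule multiset_eqI) simp
  ultimately show ?thesis
    unfolding trades_def by (intro exI[of _ ?es]) (auto simp: sum_list_replicate)
qed

text \<open>In units of 6: class 0 modulo 3 is climbed up to 3 * k + 3, class 2 descended from 3 * k
  + 2 to 2, class 1 climbed from 1 to 3 * k + 1. All of 0, ..., 3 * k + 3 are met, but the walk
  stops at 3 * k + 1.\<close>

lemma visited_run_down:
  assumes "y \<in> visited 0 (replicate (3 * k + 3) 6)"
  shows "y \<in> visited 0 (replicate (Suc k) (18::int) @ -6 # replicate k (-18) @ -6 # replicate k 18)"
proof -
  obtain i where i: "0 \<le> i" "i \<le> int (3 * k + 3)" "y = i * 6"
    using assms unfolding visited_replicate_iff by auto
  have "i = 3 * (i div 3) \<or> i = 3 * (i div 3) + 1 \<or> i = 3 * (i div 3) + 2"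
    by presburger
  then consider j where "i = 3 * j" | j where "i = 3 * j + 1" | j where "i = 3 * j + 2"
    by blast
  then show ?thesis
  proof cases
    case 1
    then have "y \<in> visited 0 (replicate (Suc k) 18)"
      unfolding visited_replicate_iff using i by (intro exI[of _ j]) auto
    then show ?thesis by (simp del: replicate_Suc)
  next
    case 3
    then have "y \<in> visited (int k * 18 + 12) (replicate k (-18))"
      unfolding visited_replicate_iff using i by (intro exI[of _ "int k - j"]) auto
    then show ?thesis by (simp add: sum_list_replicate algebra_simps)
  next
    case 2
    then have "y \<in> visited 6 (replicate k 18)"
      unfolding visited_replicate_iff using i by (intro exI[of _ j]) auto
    then show ?thesis by (simp add: sum_list_replicate algebra_simps)
  qed
qed

text \<open>One further step of 18 leads from 3 * k + 1 to 3 * k + 4 in units of 6, the end of a run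
  that is longer by one, so here the sums agree as well.\<close>

lemma trades_run_down: "trades (replicate (3 * k + 4) 6) (3 * k + 2)"
proof -
  let ?es = "replicate (Suc k) (18::int) @ -6 # replicate k (-18) @ -6 # replicate (Suc k) 18"
  have eq: "?es = (replicate (Suc k) (18::int) @ -6 # replicate k (-18) @ -6 # replicate k 18) @ [18]"
    by (simp add: replicate_append_same)
  have "replicate (3 * k + 4) (6::int) = replicate (3 * k + 3) 6 @ [6]"
    by (simp add: replicate_append_same eval_nat_numeral)
  then have "visited 0 (replicate (3 * k + 4) 6) \<subseteq> visited 0 ?es"
    unfolding eq using visited_run_down[of _ k] by (auto simp: sum_list_replicate)
  moreover have "sizes ?es + replicate_mset (3 * k + 2) 6 =
      sizes (replicate (3 * k + 4) (6::int)) + replicate_mset (3 * k + 2) 18"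
    by (rule multiset_eqI) simp
  ultimately show ?thesis
    unfolding trades_def by (intro exI[of _ ?es]) (auto simp: sum_list_replicate)
qed

text \<open>Here the run ends at 3 * k + 3 and the new walk at 3 * k + 1, which is harmless if
  nothing follows.\<close>

lemma end_trades_run_down: "end_trades (replicate (3 * k + 3) 6) (3 * k + 1)"
proof -
  let ?es = "replicate (Suc k) (18::int) @ -6 # replicate k (-18) @ -6 # replicate k 18"
  have "sizes ?es + replicate_mset (3 * k + 1) 6 =
      sizes (replicate (3 * k + 3) (6::int)) + replicate_mset (3 * k + 1) 18"
    by (rule multiset_eqI) simp
  then show ?thesis
    using visited_run_down unfolding end_trades_def by (intro exI[of _ ?es]) auto
qed

text \<open>The excluded residue is the one for which a run of \<open>c + 2\<close> sixes ends in
  its initial class modulo 3. The other two residues belong to the upward and the downward pattern;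
  surplus sixes are kept behind the exchanged part.\<close>

lemma trades_run:
  assumes "c + 2 \<le> n" "c mod 3 \<noteq> 1" shows "trades (replicate n 6) c"
proof -
  have "trades (replicate (c + 2) 6) c"
  proof (cases "c mod 3 = 0")
    case True
    then have c: "c = 3 * (c div 3)" by presburger
    show ?thesis using trades_run_up[of "c div 3"] unfolding c[symmetric] .
  next
    case False
    then have c: "c = 3 * (c div 3) + 2" using assms(2) by presburger
    have "3 * (c div 3) + 4 = c + 2" using c by presburger
    then show ?thesis using trades_run_down[of "c div 3"] c by argo
  qed
  then have "trades (replicate (c + 2) 6 @ replicate (n - (c + 2)) 6) (c + 0)"
    by (rule trades_append) simp
  moreover have "replicate n (6::int) = replicate (c + 2) 6 @ replicate (n - (c + 2)) 6"
    by (metis replicate_add le_add_diff_inverse assms(1))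
  ultimately show ?thesis by simp
qed

lemma end_trades_run:
  assumes "c + 2 \<le> n" shows "end_trades (replicate n 6) c"
proof (cases "c mod 3 = 1")
  case True
  then have c: "3 * (c div 3) + 1 = c" "3 * (c div 3) + 3 = c + 2" by presburger+
  have "end_trades (replicate (c + 2) 6) c"
    using end_trades_run_down[of "c div 3"] unfolding c .
  \<comment> \<open>The surplus sixes are put in front, as the exchanged factor has to be the last
    one.\<close>
  then have "end_trades (replicate (n - (c + 2)) 6 @ replicate (c + 2) 6) (0 + c)"
    by (intro end_trades_append) simp_all
  moreover have "replicate n (6::int) = replicate (n - (c + 2)) 6 @ replicate (c + 2) 6"
    by (metis replicate_add le_add_diff_inverse2 assms)
  ultimately show ?thesis by simp
next
  case False
  then show ?thesis using assms trades_run trades_imp_end_trades by blast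
qed

text \<open>Every number up to the bound is demanded, because c is prescribed and the lengths of the
  runs only limit it.\<close>

definition flexible :: "int list \<Rightarrow> nat \<Rightarrow> bool" where
  "flexible ds n \<longleftrightarrow> (\<forall>c\<le>n. end_trades ds c)"

lemma flexible_Cons: "flexible ds n \<Longrightarrow> flexible (d # ds) n"
  using end_trades_append[of "[d]" 0 ds] by (simp add: flexible_def)

lemma flexible_end:
  assumes "3 \<le> n" "d = 6 \<or> d = -6" shows "flexible (replicate n d) (n - 2)"
proof -
  have "end_trades (replicate n d) c" if "c \<le> n - 2" for c
  proof -
    have "end_trades (replicate n 6) c"
      using that assms(1) by (intro end_trades_run) linarith
    then show ?thesis
      using assms(2) end_trades_map_uminus[of "replicate n 6" c] by auto
  qed
  then show ?thesis by (simp add: flexible_def)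
qed

lemma Suc_mod_3: "k mod 3 = 1 \<Longrightarrow> Suc k mod 3 = 2"
  by (simp add: mod_Suc)

text \<open>Two consecutive numbers are not both 1 modulo 3, so a run of at least three sixes can
  take \<open>n - 3\<close> or \<open>n - 2\<close> trades. This is used if c is large; otherwise
  the run takes c or c - 1, and the single trade that may be left goes to the rest, which is why m
  is positive.\<close>

lemma split_trades:
  fixes c m n :: nat
  assumes c: "c \<le> m + (n - 3)" and "1 \<le> m"
  shows "\<exists>y. (y = 0 \<or> y + 2 \<le> n \<and> y mod 3 \<noteq> 1) \<and> y \<le> c \<and> c - y \<le> m"
proof (cases "n < 3")
  case True
  then have "0 \<le> c" "c - 0 \<le> m" using c by linarith+
  then show ?thesis by blast
next
  case False
  then obtain k where k: "n = k + 3" using le_Suc_ex[of 3 n] by (metis add.commute not_less)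
  have "\<exists>y. y \<le> k + 1 \<and> y mod 3 \<noteq> 1 \<and> y \<le> c \<and> c - y \<le> m"
  proof (cases "c \<le> k")
    case True
    show ?thesis
    proof (cases "c mod 3 = 1")
      case False
      moreover have "c \<le> k + 1" "c - c \<le> m" using True by linarith+
      ultimately show ?thesis by blast
    next
      case mod: True
      then obtain d where d: "c = Suc d" by (cases c) auto
      then have "(c - 1) mod 3 \<noteq> 1" using Suc_mod_3[of d] mod by auto
      moreover have "c - 1 \<le> k + 1" "c - 1 \<le> c" "c - (c - 1) \<le> m"
        using True assms(2) by linarith+
      ultimately show ?thesis by blast
    qed
  next
    case False
    have "k mod 3 \<noteq> 1 \<or> Suc k mod 3 \<noteq> 1"
      using Suc_mod_3[of k] by auto
    moreover have "k \<le> k + 1" "k \<le> c" "c - k \<le> m" "Suc k \<le> k + 1" "Suc k \<le> c" "c - Suc k \<le> m"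
      using False c k by linarith+
    ultimately show ?thesis by blast
  qed
  then obtain y where y: "y \<le> k + 1" "y mod 3 \<noteq> 1" "y \<le> c" "c - y \<le> m"
    by blast
  have "y + 2 \<le> n" using y(1) k by linarith
  then show ?thesis using y by blast
qed

text \<open>A single run cannot absorb \<open>c\<close> trades if \<open>c mod 3 = 1\<close>; then one trade is left to the
  remaining word.\<close>

lemma flexible_run:
  assumes "flexible ds m" "1 \<le> m" "d = 6 \<or> d = -6"
  shows "flexible (replicate n d @ ds) (m + (n - 3))"
proof -
  have tr: "trades (replicate n d) c" if "c = 0 \<or> c + 2 \<le> n \<and> c mod 3 \<noteq> 1" for c
  proof -
    have "trades (replicate n 6) c"
      using that trades_run[of c n] trades_0 by blast
    then show ?thesis
      using assms(3) trades_map_uminus[of "replicate n 6" c] unfolding map_replicate by blast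
  qed
  have "end_trades (replicate n d @ ds) c" if c: "c \<le> m + (n - 3)" for c
  proof -
    have "\<exists>y. (y = 0 \<or> y + 2 \<le> n \<and> y mod 3 \<noteq> 1) \<and> y \<le> c \<and> c - y \<le> m"
      using c assms(2) by (rule split_trades)
    then obtain y where y: "y = 0 \<or> y + 2 \<le> n \<and> y mod 3 \<noteq> 1" "y \<le> c" "c - y \<le> m"
      by blast
    then have "end_trades (replicate n d @ ds) (y + (c - y))"
      using assms(1) tr[OF y(1)] y(3) unfolding flexible_def by (intro end_trades_append) blast+
    then show ?thesis unfolding le_add_diff_inverse[OF y(2)] .
  qed
  then show ?thesis by (simp add: flexible_def)
qed

abbreviation triple :: "nat \<Rightarrow> nat \<Rightarrow> nat \<Rightarrow> nat multiset" where
  "triple a b c \<equiv> replicate_mset a 1 + replicate_mset b 6 + replicate_mset c 18"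

lemma in_triple: "l \<in># triple a b c \<Longrightarrow> 0 < l \<and> int l \<le> 18"
  by (auto simp: in_replicate_mset split: if_splits)

section \<open>Long runs of sixes\<close>

lemma word_traces:
  assumes "{0..<v} \<subseteq> (\<lambda>y. y mod v) ` visited 0 ds" "int (length ds) + 1 = v" "36 < v"
    and "sizes ds = triple a b c"
  shows "traces 18 v 0 (walk (step v) 0 ds) (triple a b c)"
proof -
  have small: "\<bar>d\<bar> \<le> 18" if "d \<in> set ds" for d
  proof -
    have "nat \<bar>d\<bar> \<in># sizes ds"
      using that by auto
    then have "nat \<bar>d\<bar> \<in># triple a b c"
      unfolding assms(4) .
    then show ?thesis using in_triple by fastforce
  qed
  have "walk (step v) (0 mod v) ds = map (\<lambda>y. y mod v) (walk (+) 0 ds)"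
    using small assms(3) by (intro walk_step_mod) fastforce+
  then have "set (0 # walk (step v) 0 ds) = (\<lambda>y. y mod v) ` visited 0 ds"
    unfolding visited_def by simp
  also have "\<dots> = {0..<v}"
    using assms(1,3) by (auto simp: subset_iff)
  finally have "set (0 # walk (step v) 0 ds) = {0..<v}" .
  moreover have "along (span 18 v) 0 (walk (step v) 0 ds) = map (\<lambda>d. nat \<bar>d\<bar>) ds"
    using small assms(3) by (intro along_walk_step) auto
  ultimately show ?thesis
    unfolding traces_def using assms(2,4) by simp
qed

text \<open>The exchanged word has as many letters and visits no fewer residues; as it has v - 1
  letters, it still meets every residue exactly once.\<close>

lemma flexible_realizable:
  assumes "flexible ds n" "c \<le> n" "sizes ds = triple a (b + c) 0"
    and "{0..<int v} \<subseteq> (\<lambda>y. y mod int v) ` visited 0 ds" "length ds + 1 = v" "36 < v"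
  shows "realizable v (triple a b c)"
proof -
  obtain es where es: "length es = length ds" "visited 0 ds \<subseteq> visited 0 es"
    "sizes es + replicate_mset c 6 = sizes ds + replicate_mset c 18"
    using assms(1,2) unfolding flexible_def end_trades_def by blast
  have "sizes ds + replicate_mset c 18 = triple a b c + replicate_mset c 6"
    unfolding assms(3) by (rule multiset_eqI) simp
  then have "sizes es = triple a b c"
    using es(3) by simp
  then have "traces 18 (int v) 0 (walk (step (int v)) 0 es) (triple a b c)"
    using assms(4-6) es(1,2) by (intro word_traces) auto
  then have "realizable (nat (int v)) (triple a b c)"
  proof (rule traces_realizable)
    show "2 * 18 < int v" using assms(6) by simp
  qed (fact in_triple)
  then show ?thesis by simp
qed

section \<open>Arcs of the cycle generated by 6 modulo v\<close>

primrec arcs :: "int \<Rightarrow> nat \<Rightarrow> int \<Rightarrow> nat \<Rightarrow> int list" where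
  "arcs s n e 0 = []"
| "arcs s n e (Suc j) = s # replicate n e @ arcs s n (- e) j"

text \<open>The last run can give up all but two of its sixes, each of the j runs before it all but
  three.\<close>

lemma flexible_arcs:
  assumes "3 \<le> n" "e = 6 \<or> e = -6"
  shows "flexible (arcs s n e (Suc j)) (n - 2 + j * (n - 3))"
  using assms(2)
proof (induction j arbitrary: e)
  case 0
  then show ?case using flexible_Cons[OF flexible_end[OF assms(1)]] by simp
next
  case (Suc j)
  have "flexible (arcs s n (- e) (Suc j)) (n - 2 + j * (n - 3))"
    using Suc.prems by (intro Suc.IH) auto
  then have "flexible (replicate n e @ arcs s n (- e) (Suc j)) (n - 2 + j * (n - 3) + (n - 3))"
    using Suc.prems assms(1) by (intro flexible_run) auto
  then have "flexible (arcs s n e (Suc (Suc j))) (n - 2 + j * (n - 3) + (n - 3))"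
    unfolding arcs.simps(2)[of s n e "Suc j"] by (rule flexible_Cons)
  then show ?case by (simp add: ac_simps del: arcs.simps)
qed

lemma sizes_arcs:
  assumes "s = 1 \<or> s = -1" "e = 6 \<or> e = -6"
  shows "sizes (arcs s n e j) = triple j (j * n) 0"
  using assms(2)
proof (induction j arbitrary: e)
  case (Suc j)
  then have "sizes (arcs s n (- e) j) = triple j (j * n) 0" by auto
  moreover have "nat \<bar>s\<bar> = 1" "nat \<bar>e\<bar> = 6" using assms(1) Suc.prems by auto
  ultimately show ?case
    by (intro multiset_eqI) simp
qed simp

text \<open>In units of 6 a step of \<open>s = 6 * u - v\<close> advances by \<open>u\<close> modulo \<open>v\<close>, so each arc of \<open>u\<close>
  vertices is followed by the next one, in alternating directions.\<close>

lemma arcs_visit: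
  assumes "s = 6 * int u - v" "n + 1 = u" "e = 6 \<or> e = -6"
    and "y = 6 * (if e = 6 then m - int u else m - 1) + k * v"
    and "m \<le> i" "i < m + int j * int u"
  shows "\<exists>z\<in>visited y (arcs s n e j). \<exists>k. z = 6 * i + k * v"
  using assms(3-6)
proof (induction j arbitrary: y e m k)
  case 0
  then show ?case by simp
next
  case (Suc j)
  \<comment> \<open>m is the first index of the arc to be traversed, and k counts multiples of v. An
    upward arc is entered from the lower end m - u of the stretch before it, a downward one from the
    upper end m - 1. Either way s = 6 * u - v adds u to the index and lowers k by one.\<close>
  let ?y = "y + s" and ?m = "m + int u"
  show ?case
  proof (cases "i < ?m")
    case True
    have "\<exists>z\<in>visited ?y (replicate n e). \<exists>k. z = 6 * i + k * v"
    proof (cases "e = 6")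
      case True
      then have "6 * i + (k - 1) * v \<in> visited ?y (replicate n e)"
        unfolding visited_replicate_iff using Suc.prems \<open>i < ?m\<close> assms(1,2)
        by (intro exI[of _ "i - m"]) (auto simp: algebra_simps)
      then show ?thesis by blast
    next
      case False
      then have "6 * i + (k - 1) * v \<in> visited ?y (replicate n e)"
        unfolding visited_replicate_iff using Suc.prems \<open>i < ?m\<close> assms(1,2)
        by (intro exI[of _ "m + int u - 1 - i"]) (auto simp: algebra_simps)
      then show ?thesis by blast
    qed
    then show ?thesis by auto
  next
    case False
    have "\<exists>z\<in>visited (?y + int n * e) (arcs s n (- e) j). \<exists>k. z = 6 * i + k * v"
    proof (rule Suc.IH[of "- e" _ ?m "k - 1"])
      show "?y + int n * e = 6 * (if - e = 6 then ?m - int u else ?m - 1) + (k - 1) * v"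
        using Suc.prems assms(1,2) by (auto simp: algebra_simps)
    qed (use Suc.prems False in \<open>auto simp: algebra_simps\<close>)
    then show ?thesis by (auto simp: sum_list_replicate)
  qed
qed

text \<open>As 6 * u = v + s, the indices i of the vertices 6 * i form a cycle modulo v on which s
  jumps by u. The path takes the indices 0, ..., k upwards and then a arcs of u indices each,
  entered by a jump. Since v is 6 * u up to a sign, there is room for at most five arcs besides a
  long first run. That run and all arcs but the last keep three sixes, the last arc keeps two, which
  makes \<open>3 * a + 2\<close>.\<close>

lemma realizable_arcs:
  assumes s: "s = 1 \<or> s = -1" "int v = 6 * int u - s"
    and a: "1 \<le> a" "a \<le> 5" and b: "3 * a + 2 \<le> b" and v: "a + b + c + 1 = v" "36 < v"
  shows "realizable v (triple a b c)"
proof -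
  define n where "n = u - 1"
  define k where "k = v - a * u - 1"
  have u: "6 \<le> u" using s v(2) by auto
  have au: "a = 1 \<or> a = 2 \<or> a = 3 \<or> a = 4 \<or> a = 5" using a by auto
  have k: "k + a * u + 1 = v" using au s u unfolding k_def by auto
  have n: "n + 1 = u" "3 \<le> n" using u unfolding n_def by auto
  let ?ds = "replicate k 6 @ arcs s n (-6) a"
  obtain j where j: "a = Suc j" using a by (cases a) auto
  have "flexible (arcs s n (-6) a) (n - 2 + j * (n - 3))"
    unfolding j using n(2) by (intro flexible_arcs) auto
  then have "flexible ?ds (n - 2 + j * (n - 3) + (k - 3))"
    using n by (intro flexible_run) auto
  moreover have "c \<le> n - 2 + j * (n - 3) + (k - 3)"
    using au b v(1) k n unfolding j by auto
  moreover have "sizes ?ds = triple a (b + c) 0"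
  proof -
    have "k + a * n = b + c" using au k n v(1) by auto
    then show ?thesis
      using sizes_arcs[OF s(1), of "-6" n a] by (intro multiset_eqI) auto
  qed
  moreover have "{0..<int v} \<subseteq> (\<lambda>y. y mod int v) ` visited 0 ?ds"
  proof
    fix r assume r: "r \<in> {0..<int v}"
    \<comment> \<open>By 6 * u = v + s and s * s = 1, the inverse of 6 modulo v is s * u, so i is
      the index of the vertex r.\<close>
    define i where "i = (s * int u * r) mod int v"
    have i: "0 \<le> i" "i < int v" using v(2) unfolding i_def by auto
    have "6 * i mod int v = (6 * (s * int u * r)) mod int v"
      unfolding i_def by (simp add: mod_simps)
    also have "6 * (s * int u * r) = r + s * r * int v"
    proof -
      have "6 * (s * int u * r) = s * r * (int v + s)" using s(2) by simp
      moreover have "s * s = 1" using s(1) by auto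
      ultimately show ?thesis by (simp add: algebra_simps)
    qed
    also have "\<dots> mod int v = r" using r by simp
    finally have ir: "6 * i mod int v = r" .
    have "\<exists>z\<in>visited 0 ?ds. \<exists>k. z = 6 * i + k * int v"
    proof (cases "i \<le> int k")
      case True
      then have "6 * i \<in> visited 0 (replicate k 6)"
        unfolding visited_replicate_iff using i by (intro exI[of _ i]) auto
      then show ?thesis by (auto intro!: bexI[of _ "6 * i"] exI[of _ 0])
    next
      case False
      have "\<exists>z\<in>visited (int k * 6) (arcs s n (-6) a). \<exists>k. z = 6 * i + k * int v"
      proof (rule arcs_visit)
        show "s = 6 * int u - int v" using s by simp
        show "n + 1 = u" by fact
        show "int k * 6 = 6 * (if (-6::int) = 6 then int k + 1 - int u else int k + 1 - 1) + 0 * int v"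
          by simp
        show "i < int k + 1 + int a * int u" using i k by (simp flip: of_nat_mult)
      qed (use False in auto)
      then show ?thesis by (auto simp: sum_list_replicate)
    qed
    then obtain z q where "z \<in> visited 0 ?ds" "z = 6 * i + q * int v" by blast
    then show "r \<in> (\<lambda>y. y mod int v) ` visited 0 ?ds"
      using ir by (intro image_eqI[of _ _ z]) auto
  qed
  moreover have "length ?ds + 1 = v"
  proof -
    have "size (sizes ?ds) = a + (b + c)"
      using \<open>sizes ?ds = triple a (b + c) 0\<close> by (metis size_union size_replicate_mset add_0_right)
    then show ?thesis using v(1) by simp
  qed
  ultimately show ?thesis using v(2) by (rule flexible_realizable)
qed

section \<open>Zigzags through six columns of vertices congruent modulo 6\<close>

definition columns :: "nat \<Rightarrow> int list" where
  "columns h = replicate (h - 1) 6 @ 1 # replicate (h - 1) (-6)"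

lemma sum_columns [simp]: "sum_list (columns h) = 1"
  by (simp add: columns_def sum_list_replicate)

lemma visited_columns:
  assumes "0 \<le> j" "j < int h" "i = 0 \<or> i = 1"
  shows "u + i + 6 * j \<in> visited u (columns h)"
  using assms(3)
proof
  assume "i = 0"
  then have "u + i + 6 * j \<in> visited u (replicate (h - 1) 6)"
    unfolding visited_replicate_iff using assms by (intro exI[of _ j]) auto
  then show ?thesis by (simp add: columns_def)
next
  assume "i = 1"
  then have "u + i + 6 * j \<in> visited (u + int (h - 1) * 6 + 1) (replicate (h - 1) (-6))"
    unfolding visited_replicate_iff using assms by (intro exI[of _ "int h - 1 - j"]) (auto simp: algebra_simps)
  then show ?thesis by (simp add: columns_def sum_list_replicate algebra_simps)
qed

lemma flexible_columns:
  assumes "flexible ds m" "1 \<le> m"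
  shows "flexible (columns h @ ds) (m + (h - 4) + (h - 4))"
proof -
  have "flexible (replicate (h - 1) (-6) @ ds) (m + (h - 1 - 3))"
    using assms by (intro flexible_run) auto
  then have "flexible (replicate (h - 1) 6 @ 1 # replicate (h - 1) (-6) @ ds)
      (m + (h - 1 - 3) + (h - 1 - 3))"
    by (rule flexible_run[OF flexible_Cons]) (use assms(2) in auto)
  then show ?thesis by (simp add: columns_def)
qed

text \<open>After t steps of 1 the vertices from t on are cut into six columns by their residues
  modulo 6. Two pairs of columns, of heights g and h, are run up and down, each ending at the bottom
  next to the following pair. The last pair is left to ds, whose shape decides the parity of the
  number of sixes.\<close>

definition zigzag :: "nat \<Rightarrow> nat \<Rightarrow> nat \<Rightarrow> int list \<Rightarrow> int list" where
  "zigzag t g h ds = replicate t 1 @ columns g @ 1 # columns h @ 1 # ds"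

lemma flexible_Ones: "flexible ds m \<Longrightarrow> flexible (replicate t 1 @ ds) m"
  by (induction t) (auto intro: flexible_Cons)

lemma flexible_zigzag:
  assumes "flexible ds m" "1 \<le> m"
  shows "flexible (zigzag t g h ds) (m + 2 * (h - 4) + 2 * (g - 4))"
proof -
  have "flexible (columns h @ 1 # ds) (m + (h - 4) + (h - 4))"
    by (rule flexible_columns[OF flexible_Cons[OF assms(1)] assms(2)])
  then have "flexible (columns g @ 1 # columns h @ 1 # ds)
      (m + (h - 4) + (h - 4) + (g - 4) + (g - 4))"
    by (rule flexible_columns[OF flexible_Cons]) (use assms(2) in auto)
  then show ?thesis
    unfolding zigzag_def by (intro flexible_Ones) (simp add: mult_2 add.assoc)
qed

text \<open>The heights g, h, q do not increase from left to right and differ by at most one, so the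
  columns fill an interval: all levels below the top one are complete, and the top one is filled
  from the left.\<close>

lemma zigzag_visits:
  assumes "q \<le> h" "h \<le> g" "g \<le> q + 1"
    and ds: "\<And>u i j. i = 0 \<or> i = 1 \<Longrightarrow> 0 \<le> j \<Longrightarrow> j < int q \<Longrightarrow> u + i + 6 * j \<in> visited u ds"
  shows "{0..<int (t + 2 * g + 2 * h + 2 * q)} \<subseteq> visited 0 (zigzag t g h ds)"
proof
  fix y assume y: "y \<in> {0..<int (t + 2 * g + 2 * h + 2 * q)}"
  show "y \<in> visited 0 (zigzag t g h ds)"
  proof (cases "y < int t")
    case True
    then have "y \<in> visited 0 (replicate t 1)"
      unfolding visited_replicate_iff using y by (intro exI[of _ y]) auto
    then show ?thesis by (simp add: zigzag_def)
  next
    case False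
    define j where "j = (y - int t) div 6"
    define i where "i = (y - int t) mod 6"
    have ij: "y = int t + i + 6 * j" "0 \<le> j" "0 \<le> i" "i < 6"
      using False unfolding i_def j_def by (auto simp: pos_imp_zdiv_nonneg_iff)
    then consider "i = 0 \<or> i = 1" | "i - 2 = 0 \<or> i - 2 = 1" | "i - 4 = 0 \<or> i - 4 = 1"
      by linarith
    then show ?thesis
    proof cases
      case 1
      moreover have "j < int g" using 1 y ij assms(1-3) by auto
      ultimately have "int t + i + 6 * j \<in> visited (int t) (columns g)"
        using ij by (intro visited_columns) auto
      then show ?thesis using ij by (simp add: zigzag_def sum_list_replicate)
    next
      case 2
      moreover have "j < int h" using 2 y ij assms(1-3) by auto
      ultimately have "(2 + int t) + (i - 2) + 6 * j \<in> visited (2 + int t) (columns h)"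
        using ij by (intro visited_columns) auto
      then show ?thesis using ij by (simp add: zigzag_def sum_list_replicate)
    next
      case 3
      moreover have "j < int q" using 3 y ij assms(1-3) by auto
      ultimately have "(4 + int t) + (i - 4) + 6 * j \<in> visited (4 + int t) ds"
        using ij by (intro ds) auto
      then show ?thesis using ij by (simp add: zigzag_def sum_list_replicate)
    qed
  qed
qed

lemma realizable_zigzag:
  assumes q: "q \<le> h" "h \<le> g" "g \<le> q + 1" "1 \<le> q"
    and ds: "\<And>u i j. i = 0 \<or> i = 1 \<Longrightarrow> 0 \<le> j \<Longrightarrow> j < int q \<Longrightarrow> u + i + 6 * j \<in> visited u ds"
    and fl: "flexible ds m" "1 \<le> m" and sz: "sizes ds = triple a' b' 0" "a' + b' + 1 = 2 * q"
    and v: "v = t + 2 * g + 2 * h + 2 * q" "36 < v"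
    and a: "a = t + 4 + a'" and b: "b + c = b' + 2 * (g - 1) + 2 * (h - 1)"
    and c: "c \<le> m + 2 * (h - 4) + 2 * (g - 4)"
  shows "realizable v (triple a b c)"
proof -
  have columns: "sizes (columns n) = triple 1 (2 * (n - 1)) 0" for n
    by (rule multiset_eqI) (simp add: columns_def)
  have S: "sizes (zigzag t g h ds) = triple a (b + c) 0"
    unfolding a b using sz(1) columns[of g] columns[of h]
    by (intro multiset_eqI) (simp add: zigzag_def)
  have "{0..<int v} \<subseteq> (\<lambda>y. y mod int v) ` visited 0 (zigzag t g h ds)"
  proof
    fix y assume y: "y \<in> {0..<int v}"
    then have "y \<in> visited 0 (zigzag t g h ds)"
      using zigzag_visits[OF q(1-3) ds, of t] unfolding v(1) by blast
    then show "y \<in> (\<lambda>y. y mod int v) ` visited 0 (zigzag t g h ds)"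
      using y by (intro image_eqI[of _ _ y]) auto
  qed
  moreover have "length (zigzag t g h ds) + 1 = v"
  proof -
    have "size (sizes (zigzag t g h ds)) = a + (b + c)"
      unfolding S by (metis size_union size_replicate_mset add_0_right)
    then show ?thesis using q sz(2) a b v(1) by simp
  qed
  ultimately show ?thesis
    using flexible_zigzag[OF fl, of t g h] c S v(2) flexible_realizable by blast
qed

text \<open>The remainder of n modulo 6 is 0, 2 or 4, so none, one or two pairs of columns are
  higher than q by one.\<close>

lemma column_heights:
  fixes n :: nat
  assumes "even n"
  obtains q g h where "q \<le> h" "h \<le> g" "g \<le> q + 1" "n = 2 * g + 2 * h + 2 * q" "q = n div 6"
proof -
  define q where "q = n div 6"
  have "n mod 6 = 0 \<or> n mod 6 = 2 \<or> n mod 6 = 4"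
    using assms by presburger
  moreover have "n = 6 * q + n mod 6" unfolding q_def by simp
  ultimately consider "n = 6 * q" | "n = 6 * q + 2" | "n = 6 * q + 4"
    by linarith
  then show ?thesis
  proof cases
    case 1
    then show ?thesis by (intro that[of q q q, OF _ _ _ _ q_def]) simp_all
  next
    case 2
    then show ?thesis by (intro that[of q q "q + 1", OF _ _ _ _ q_def]) simp_all
  next
    case 3
    then show ?thesis by (intro that[of q "q + 1" "q + 1", OF _ _ _ _ q_def]) simp_all
  qed
qed

text \<open>Six columns are joined by five edges of length 1, so \<open>a - 5\<close> ones lead up
  to them. The columns come in pairs of equal height, which makes the number of sixes even. Of the
  six runs, five keep three sixes and the last keeps two, together 17. For b + c at least 18 all
  heights are at least 4, so no run has fewer than three sixes.\<close>

lemma realizable_zigzag_even: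
  assumes "5 \<le> a" "17 \<le> b" "18 \<le> b + c" "even (b + c)" "v = a + b + c + 1" "36 < v"
  shows "realizable v (triple a b c)"
proof -
  obtain q g h where q: "q \<le> h" "h \<le> g" "g \<le> q + 1" "b + c + 6 = 2 * g + 2 * h + 2 * q"
    "q = (b + c + 6) div 6"
    using column_heights[of "b + c + 6"] assms(4) by (metis even_add even_numeral)
  then have "4 \<le> q" using assms(3) by linarith
  have fl: "flexible (columns q) (q - 1 - 2 + (q - 1 - 3))"
    unfolding columns_def using \<open>4 \<le> q\<close> by (intro flexible_run flexible_Cons flexible_end) auto
  have sz: "sizes (columns q) = triple 1 (2 * (q - 1)) 0"
    by (rule multiset_eqI) (simp add: columns_def)
  show ?thesis
  proof (rule realizable_zigzag[where t = "a - 5", OF q(1-3) _ _ fl _ sz])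
    show "u + i + 6 * j \<in> visited u (columns q)" if "i = 0 \<or> i = 1" "0 \<le> j" "j < int q" for u i j
      using that by (intro visited_columns)
    show "v = a - 5 + 2 * g + 2 * h + 2 * q" using q(4) assms(1,5) by linarith
    show "b + c = 2 * (q - 1) + 2 * (g - 1) + 2 * (h - 1)"
      using q(1,2,4) \<open>4 \<le> q\<close> by linarith
    show "c \<le> q - 1 - 2 + (q - 1 - 3) + 2 * (h - 4) + 2 * (g - 4)"
      using q(1,2,4) \<open>4 \<le> q\<close> assms(2) by linarith
  qed (use \<open>4 \<le> q\<close> assms(1,6) in linarith)+
qed

text \<open>For an odd number of sixes the last pair is traversed from the bottom of the fifth
  column across to the sixth, up, back across at the top and down the fifth to level 1. This takes
  one more edge of length 1 and one six less. The last run has only \<open>q - 2\<close> sixes,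
  hence the bound 23, which gives q at least 5.\<close>

lemma realizable_zigzag_odd:
  assumes "6 \<le> a" "17 \<le> b" "23 \<le> b + c" "odd (b + c)" "v = a + b + c + 1" "36 < v"
  shows "realizable v (triple a b c)"
proof -
  obtain q g h where q: "q \<le> h" "h \<le> g" "g \<le> q + 1" "b + c + 7 = 2 * g + 2 * h + 2 * q"
    "q = (b + c + 7) div 6"
    using column_heights[of "b + c + 7"] assms(4) by (metis odd_even_add odd_numeral)
  then have "5 \<le> q" using assms(3) by linarith
  let ?ds = "1 # replicate (q - 1) 6 @ -1 # replicate (q - 2) (-6)"
  have fl: "flexible ?ds (q - 2 - 2 + (q - 1 - 3))"
    using \<open>5 \<le> q\<close> by (intro flexible_run flexible_Cons flexible_end) auto
  have sz: "sizes ?ds = triple 2 (2 * q - 3) 0"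
    using \<open>5 \<le> q\<close> by (intro multiset_eqI) auto
  have vis: "u + i + 6 * j \<in> visited u ?ds" if "i = 0 \<or> i = 1" "0 \<le> j" "j < int q" for u i j
  proof -
    have "i = 1 \<or> i = 0 \<and> j = 0 \<or> i = 0 \<and> 1 \<le> j"
      using that by linarith
    then consider "i = 1" | "i = 0" "j = 0" | "i = 0" "1 \<le> j" by blast
    then show ?thesis
    proof cases
      case 1
      then have "u + i + 6 * j \<in> visited (u + 1) (replicate (q - 1) 6)"
        unfolding visited_replicate_iff using that by (intro exI[of _ j]) auto
      then show ?thesis by simp
    next
      case 2
      then show ?thesis by simp
    next
      case 3
      then have "u + i + 6 * j \<in> visited (u + int (q - 1) * 6) (replicate (q - 2) (-6))"
        unfolding visited_replicate_iff using that \<open>5 \<le> q\<close>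
        by (intro exI[of _ "int q - 1 - j"]) auto
      then show ?thesis by (simp add: sum_list_replicate algebra_simps)
    qed
  qed
  show ?thesis
  proof (rule realizable_zigzag[where t = "a - 6", OF q(1-3) _ vis fl _ sz])
    show "v = a - 6 + 2 * g + 2 * h + 2 * q" using q(4) assms(1,5) by linarith
    show "b + c = 2 * q - 3 + 2 * (g - 1) + 2 * (h - 1)"
      using q(1,2,4) \<open>5 \<le> q\<close> by linarith
    show "c \<le> q - 2 - 2 + (q - 1 - 3) + 2 * (h - 4) + 2 * (g - 4)"
      using q(1,2,4) \<open>5 \<le> q\<close> assms(2) by linarith
  qed (use \<open>5 \<le> q\<close> assms(1,6) in linarith)+
qed

section \<open>Tables of paths\<close>

primrec bits :: "num \<Rightarrow> bool list" where
  "bits num.One = []"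
| "bits (num.Bit0 n) = False # bits n"
| "bits (num.Bit1 n) = True # bits n"

definition bits_of :: "int \<Rightarrow> bool list" where
  "bits_of k = bits (num_of_nat (nat k))"

text \<open>Positive literals reach the evaluation as \<open>Int.Pos n\<close>, so the digits are
  read off the numeral constructor by constructor, without any division.\<close>

lemma bits_of_Pos [code]: "bits_of (Int.Pos n) = bits n"
  by (simp add: bits_of_def num_of_nat_numeral_eq)

primrec int_of_bits :: "bool list \<Rightarrow> int" where
  "int_of_bits [] = 0"
| "int_of_bits (x # bs) = (if x then 1 else 0) + 2 * int_of_bits bs"

text \<open>Words are coded by the octal digits of a number below its leading 1, least significant digit
  first: the letters 1, -1, 6, -6, 18, -18 are the digits 0, 1, 2, 3, 4, 5.\<close>

fun letters :: "bool list \<Rightarrow> int list" where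
  "letters (x # y # z # bs) =
     (let d = (if z then 18 else if y then 6 else 1) in (if x then - d else d) # letters bs)"
| "letters _ = []"

lemma set_letters: "set (letters bs) \<subseteq> {1, -1, 6, -6, 18, -18}"
  by (induction bs rule: letters.induct) auto

primrec occurrences :: "int \<Rightarrow> int list \<Rightarrow> int" where
  "occurrences k [] = 0"
| "occurrences k (d # ds) = (if \<bar>d\<bar> = k then 1 + occurrences k ds else occurrences k ds)"

lemma occurrences_nonneg [simp]: "0 \<le> occurrences k ds"
  by (induction ds) auto

lemma sizes_letters:
  assumes "set ds \<subseteq> {1, -1, 6, -6, 18, -18}"
  shows "sizes ds = triple (nat (occurrences 1 ds)) (nat (occurrences 6 ds)) (nat (occurrences 18 ds))"
  using assms
proof (induction ds)
  case (Cons d ds)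
  then have IH: "sizes ds =
      triple (nat (occurrences 1 ds)) (nat (occurrences 6 ds)) (nat (occurrences 18 ds))"
    by simp
  have "\<bar>d\<bar> = 1 \<or> \<bar>d\<bar> = 6 \<or> \<bar>d\<bar> = 18" using Cons.prems by auto
  then show ?case
    using IH by (elim disjE) (simp_all add: nat_add_distrib)
qed simp

section \<open>Merge sort as a test for permutations\<close>

fun merge :: "int list \<Rightarrow> int list \<Rightarrow> int list" where
  "merge [] ys = ys"
| "merge (x # xs) [] = x # xs"
| "merge (x # xs) (y # ys) = (if x \<le> y then x # merge xs (y # ys) else y # merge (x # xs) ys)"

fun merge_pairs :: "int list list \<Rightarrow> int list list" where
  "merge_pairs (xs # ys # zss) = merge xs ys # merge_pairs zss"
| "merge_pairs zss = zss"

lemma length_merge_pairs [termination_simp]: "length (merge_pairs zss) \<le> length zss"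
  by (induction zss rule: merge_pairs.induct) auto

fun merge_all :: "int list list \<Rightarrow> int list" where
  "merge_all [] = []"
| "merge_all [xs] = xs"
| "merge_all (xs # ys # zss) = merge_all (merge xs ys # merge_pairs zss)"

definition msort :: "int list \<Rightarrow> int list" where
  "msort xs = merge_all (map (\<lambda>x. [x]) xs)"

lemma mset_merge: "mset (merge xs ys) = mset xs + mset ys"
  by (induction xs ys rule: merge.induct) auto

lemma mset_merge_pairs: "mset (concat (merge_pairs zss)) = mset (concat zss)"
  by (induction zss rule: merge_pairs.induct) (auto simp: mset_merge)

lemma mset_merge_all: "mset (merge_all zss) = mset (concat zss)"
  by (induction zss rule: merge_all.induct) (auto simp: mset_merge mset_merge_pairs simp del: mset_concat)

lemma mset_msort: "mset (msort xs) = mset xs"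
proof -
  have "concat (map (\<lambda>x. [x]) xs) = xs" by (induction xs) auto
  then show ?thesis by (simp add: msort_def mset_merge_all del: mset_concat)
qed

text \<open>\<open>msort\<close> is only known to permute its list; the comparison with an interval
  is made on its output, and that determines the multiset.\<close>

lemma msort_eq_upto:
  assumes "msort xs = [i..j]" shows "mset xs = mset_set {i..j}"
  using assms mset_msort[of xs] by (metis distinct_upto mset_set_set set_upto)

text \<open>The six lowest bits hold the first vertex, for which they suffice as v is at most 53 in
  the table; the word follows. Edges may run around the cycle. The second test makes the path
  stretchable at 18, so that one code also serves the multiplicities of 18 that are larger by a
  multiple of 18.\<close>

definition cyclic_path :: "int \<Rightarrow> int \<Rightarrow> int \<Rightarrow> int \<Rightarrow> bool" where
  "cyclic_path a b v k \<longleftrightarrow>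
     (let bs = bits_of k; u = int_of_bits (take 6 bs); ds = letters (drop 6 bs); p = walk (step v) u ds
      in msort (u # p) = [0..v - 1] \<and> msort (crossings 18 u p) = [0..17] \<and>
        occurrences 1 ds = a \<and> occurrences 6 ds = b)"

text \<open>Plain addition in place of \<open>step\<close> keeps the path from wrapping around, and
  it starts at 0; prefixing relies on both. Paths with fewer than 18 eighteens are never stretched,
  so stretchability is tested from 18 on.\<close>

definition linear_path :: "int \<Rightarrow> int \<Rightarrow> int \<Rightarrow> int \<Rightarrow> bool" where
  "linear_path a b c k \<longleftrightarrow>
     (let ds = letters (bits_of k); p = walk (+) 0 ds
      in msort (0 # p) = [0..a + b + c] \<and> (18 \<le> c \<longrightarrow> msort (crossings 18 0 p) = [0..17]) \<and>
        occurrences 1 ds = a \<and> occurrences 6 ds = b)"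

lemma msort_path:
  assumes "msort (u # p) = [0..v - 1]"
  shows "set (u # p) = {0..<v}" "int (length p) + 1 = v"
proof -
  have m: "mset (u # p) = mset_set {0..v - 1}"
    using assms by (rule msort_eq_upto)
  have "set (u # p) = set_mset (mset_set {0..v - 1})"
    unfolding m[symmetric] by simp
  also have "\<dots> = {0..<v}" by auto
  finally show *: "set (u # p) = {0..<v}" .
  have "u \<in> set (u # p)" by simp
  then have "0 < v" unfolding * by simp
  moreover have "size (mset (u # p)) = card {0..v - 1}"
    unfolding m by simp
  ultimately show "int (length p) + 1 = v" by simp
qed

lemma growable_18I: "msort (crossings 18 u p) = [0..17] \<Longrightarrow> growable 18 u p"
proof -
  assume "msort (crossings 18 u p) = [0..17]"
  moreover have "{0..17} = {0..<18::int}" by auto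
  ultimately show ?thesis unfolding growable_def by (metis msort_eq_upto)
qed

text \<open>The tests count only ones and sixes; the length accounts for the eighteens.\<close>

lemma sizes_eq_triple:
  assumes "set ds \<subseteq> {1, -1, 6, -6, 18, -18}" "occurrences 1 ds = int a" "occurrences 6 ds = int b"
    and "length ds = a + b + c"
  shows "sizes ds = triple a b c"
proof -
  have eq: "sizes ds = triple a b (nat (occurrences 18 ds))"
    using sizes_letters[OF assms(1)] assms(2,3) by simp
  have "length ds = size (sizes ds)" by simp
  also have "\<dots> = a + b + nat (occurrences 18 ds)" unfolding eq by simp
  finally show ?thesis using eq assms(4) by simp
qed

lemma traces_grow_triple:
  assumes "traces 18 v u p (triple a b c)" "growable 18 u p" "36 \<le> v"
  shows "\<exists>u' p'. traces 18 (v + int j * 18) u' p' (triple a b (c + j * 18)) \<and>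
    (u = 0 \<and> unwrapped 18 0 p \<longrightarrow> u' = 0 \<and> unwrapped 18 0 p')"
proof -
  have eq: "triple a b c + replicate_mset (j * nat 18) (nat 18) = triple a b (c + j * 18)"
    by (rule multiset_eqI) simp
  have "\<exists>u' p'. traces 18 (v + int j * 18) u' p'
      (triple a b c + replicate_mset (j * nat 18) (nat 18)) \<and>
      (u = 0 \<and> unwrapped 18 0 p \<longrightarrow> u' = 0 \<and> unwrapped 18 0 p')"
  proof (rule traces_grow_iterate[OF assms(1,2)])
    show "int l \<le> 18" if "l \<in># triple a b c" for l
      using in_triple[OF that] by simp
  qed (use assms(3) in simp_all)
  then show ?thesis unfolding eq .
qed

lemma cyclic_path_realizable:
  assumes "cyclic_path (int a) (int b) (int w) k" "36 < w" "w = a + b + c + 1"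
  shows "realizable (w + 18 * j) (triple a b (c + 18 * j))"
proof -
  obtain u ds where p: "msort (u # walk (step (int w)) u ds) = [0..int w - 1]"
    "msort (crossings 18 u (walk (step (int w)) u ds)) = [0..17]"
    and occ: "occurrences 1 ds = int a" "occurrences 6 ds = int b"
    and ds: "set ds \<subseteq> {1, -1, 6, -6, 18, -18}"
    using assms(1) set_letters unfolding cyclic_path_def Let_def by blast
  let ?p = "walk (step (int w)) u ds"
  note path = msort_path[OF p(1)]
  have "sizes ds = triple a b c"
    using ds occ by (rule sizes_eq_triple) (use path(2) assms(3) in simp)
  moreover have "along (span 18 (int w)) u ?p = map (\<lambda>d. nat \<bar>d\<bar>) ds"
  proof (rule along_walk_step)
    show "0 \<le> u" "u < int w" using path(1) by auto
    show "\<bar>d\<bar> \<le> 18" if "d \<in> set ds" for d using that ds by auto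
  qed (use assms(2) in auto)
  ultimately have t: "traces 18 (int w) u ?p (triple a b c)"
    using path unfolding traces_def by simp
  have "36 \<le> int w" using assms(2) by simp
  with traces_grow_triple[OF t growable_18I[OF p(2)], of j]
  obtain u' p' where "traces 18 (int w + int j * 18) u' p' (triple a b (c + j * 18))" by blast
  moreover have "int w + int j * 18 = int (w + 18 * j)" "c + j * 18 = c + 18 * j" by simp_all
  ultimately have "traces 18 (int (w + 18 * j)) u' p' (triple a b (c + 18 * j))"
    by (simp only:)
  then have "realizable (nat (int (w + 18 * j))) (triple a b (c + 18 * j))"
  proof (rule traces_realizable)
    show "2 * 18 < int (w + 18 * j)" using assms(2) by simp
  qed (fact in_triple)
  then show ?thesis by (simp only: nat_int)
qed

text \<open>Stretching comes before prefixing: it preserves the start at 0 and the absence of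
  wrapping, whereas a prefixed edge shifts the path against the fixed place 18 of stretching. The
  coded path itself may be short; only the final one has to have more than 36 vertices.\<close>

lemma linear_path_realizable:
  assumes "linear_path (int a) (int b) (int c) k" "j = 0 \<or> 18 \<le> c \<and> 35 \<le> a + b + c" "36 < a + i + b + c + 18 * j + 1"
  shows "realizable (a + i + b + c + 18 * j + 1) (triple (a + i) b (c + 18 * j))"
proof -
  obtain ds where p: "msort (0 # walk (+) 0 ds) = [0..int (a + b + c + 1) - 1]"
    "18 \<le> c \<longrightarrow> msort (crossings 18 0 (walk (+) 0 ds)) = [0..17]"
    and occ: "occurrences 1 ds = int a" "occurrences 6 ds = int b"
    and ds: "set ds \<subseteq> {1, -1, 6, -6, 18, -18}"
    using assms(1) set_letters unfolding linear_path_def Let_def by fastforce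
  let ?p = "walk (+) (0::int) ds"
  note path = msort_path[OF p(1)]
  have "sizes ds = triple a b c"
    using ds occ by (rule sizes_eq_triple) (use path(2) in simp)
  moreover have "\<bar>d\<bar> \<le> 18" if "d \<in> set ds" for d using that ds by auto
  ultimately have t: "traces 18 (int (a + b + c + 1)) 0 ?p (triple a b c)" and u: "unwrapped 18 0 ?p"
    using path along_walk_plus[of ds 18 _ 0] unfolding traces_def by simp_all
  have "\<exists>p. traces 18 (int (a + b + c + 1) + int j * 18) 0 p (triple a b (c + j * 18)) \<and> unwrapped 18 0 p"
  proof (cases "j = 0")
    case True
    then show ?thesis using t u by auto
  next
    case False
    then have c: "18 \<le> c" "35 \<le> a + b + c" using assms(2) by simp_all
    have "growable 18 0 ?p"
      using growable_18I p(2) c(1) by blast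
    moreover have "36 \<le> int (a + b + c + 1)"
      using c(2) by simp
    ultimately show ?thesis
      using traces_grow_triple[OF t, of j] u by blast
  qed
  moreover have "int (a + b + c + 1) + int j * 18 = int (a + b + c + 18 * j + 1)"
    "c + j * 18 = c + 18 * j" by simp_all
  ultimately obtain p where
    "traces 18 (int (a + b + c + 18 * j + 1)) 0 p (triple a b (c + 18 * j))" "unwrapped 18 0 p"
    by (simp only:) blast
  then have "\<exists>p. traces 18 (int (a + i + b + c + 18 * j + 1)) 0 p (triple (a + i) b (c + 18 * j)) \<and>
      unwrapped 18 0 p"
  proof (induction i)
    case 0
    then show ?case by auto
  next
    case (Suc i)
    then obtain p where p:
      "traces 18 (int (a + i + b + c + 18 * j + 1)) 0 p (triple (a + i) b (c + 18 * j))"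
      "unwrapped 18 0 p" by blast
    have "traces 18 (int (a + i + b + c + 18 * j + 1) + 1) 0 (1 # map (\<lambda>y. y + 1) p)
        (add_mset 1 (triple (a + i) b (c + 18 * j)))" "unwrapped 18 0 (1 # map (\<lambda>y. y + 1) p)"
      by (rule traces_Cons_0[OF p], simp)+
    moreover have "int (a + i + b + c + 18 * j + 1) + 1 = int (a + Suc i + b + c + 18 * j + 1)"
      "add_mset 1 (triple (a + i) b (c + 18 * j)) = triple (a + Suc i) b (c + 18 * j)" by simp_all
    ultimately show ?case by (simp only:) blast
  qed
  then obtain p where
    "traces 18 (int (a + i + b + c + 18 * j + 1)) 0 p (triple (a + i) b (c + 18 * j))" by blast
  then have "realizable (nat (int (a + i + b + c + 18 * j + 1))) (triple (a + i) b (c + 18 * j))"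
  proof (rule traces_realizable)
    show "2 * 18 < int (a + i + b + c + 18 * j + 1)" using assms(3) by simp
  qed (fact in_triple)
  then show ?thesis by (simp only: nat_int)
qed

text \<open>The pairs (a, b) are those below the thresholds of the other constructions:
  \<open>b \<le> 3 * a + 1\<close> for a up to 5 and \<open>a + b \<le> 16\<close> for a from 6 on.
  Each has one path for every v from 37 to 54 that is prime to 6; these are the least values above
  36 in the six classes modulo 18.\<close>

definition cyclic_table :: "int list list list" where
  "cyclic_table = [
    [
      [35604321310675173456604064174459148, 133682358432628960984527429187570948963,
      8555670939497433888382766207428119906600, 35044028169117739721555800366316563576839016,
      2445316533778165915215129881052707693563889937,
      9186581720365675207692972955565156023703558330634],
      [34889366377128548713587399267076352, 142986954403719976986824570321820076328,
      9060967467838362937879179140627896092930, 38136271260863523964560930731096918327445761,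
      2376622274014834792345349147393009312970459405,
      9985776711866160072614803760411785345112506255617],
      [32034442675878998104597866029926687, 131127145701512737818872905274152339751,
      7968072055866554547090154590143574591754, 37133799407914439251197829137602929176496384,
      2242425797536958292257338675063578658977499408,
      9016471635991283891984819946563633249913941711720],
      [29960016471670983059903596897387355, 131213082271003343833328339234074020100,
      8397349351469292869114234176578377632042, 32169244498809424824377322191598375230654761,
      2242817644835407861060032128085326448194373894,
      8555674523774788257850244616512867801993258879142]],
    [
      [35604321315019750614264660190447879, 140289927064058407004862349775832500482,
      8895948114350525816138766980196041415515, 36437824744025020839805197547295481609210120,
      2231368759529762746975141505303726925567641865,
      9642791250712758070774552430110244143297853540613],
      [28723513857547605407464390197922059, 99312320256500513836863707560417876820,
      8482753289671924533161576086459519224067, 28075045294576255039176217421980728290330890,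
      1662998427661854887716467301944289716853688583,
      9820469252261309178992084628903600098618191043435],
      [32337976731082942391565823392537441, 145835158132045609924703327574788557058,
      9147314993717487041729010332496429505362, 23812742328570535411511216068197413593172266,
      2446710330346172115308165647104526085126244617,
      9550724017957200319222100546472216825195681433864],
      [35603895069838650706382204872088405, 142906129556046821672331627447300053858,
      8482753289618685555690379126152941947176, 37466131472302874919019988424719202778536807,
      2440982250932454261533864620033372454862866688,
      9001753144160253513766349646018116830638099286310],
      [32008465529248289375139676797683985, 141653867371261155649199274835276389207,
      8390808015517615130480144724782126090536, 38229843345613684292911506506213240045979937,
      2237639482987292436409534919007125782419097866,
      9825568158359916075966011160157891097610620651785],
      [34259884947830707410685725842458782, 132541979953260500992287790990886061923,
      7288851674830019405407094018816096000865, 34368749549522875327588566332757907470436613,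
      2058831534747308567166531857248040553662269700,
      9158036766511517716882475423088619853555247961349],
      [32627877391665386066508783585216780, 133643785782760086954190387117850708239,
      8875676571772197981645663293896299830105, 29468839400918624956954876644373997043493123,
      2201315018162531771872820069161740292213557517,
      7464097647797103172930898342196727128124251846400]],
    [
      [35393257485737173261254863090764044, 128553982312928676722362949120350636295,
      8309265300007381894268416402958239325012, 34036761980679378301018710749712588899240199,
      2354142637514837349641201286375800329833957635,
      9153218809979690576456579768923618541589283096845],
      [34259887251420641844734418255759629, 140288573213217387162841870824388053287,
      9290816292643837209374680291675718437136, 35044028087970312108584590061820267231370080,
      1975082275400789174781575821070101715116022629,
      8833337916420704024577942296285575966088223672593],
      [34894184359636918265812060189678435, 145313103396288573481508146723660368737,
      8555670001435933806673851923268417767715, 34368907953128819494084757330323723756128515,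
      2376497774722953499598018952683118183908002050,
      9963004465192228425466077884159695017095617502047],
      [24552135008031874062263575360194847, 123048534465785644934546836141462669572,
      8477246485994402570863658332370526198632, 34984916260636025170706465084843984688400650,
      2156800635627488273113904149488031907294890249,
      9814505543221950206741216651662480103283696786260],
      [31861929499089904439376742089640225, 133681090781461434194914949468519549188,
      7848711532275708555618378513388701632801, 34045056357809906099092564379830362485704970,
      1508857317288054737496862765671089135014042457,
      9016471635991273791698888179267380882803950803808],
      [32637105243025704255487185509304590, 133596684352539882640348238919740348171,
      8289405109177444060844430604754748590346, 29867068940121082683511126035842722897971435,
      2375609577488686798928895592427655556240656655,
      9153958912980762671035208200123734508923851523443],
      [34563543934950780538194409328625932, 145728430774188925941288873833364867344,
      9060402789618857677138341257311209998605, 34955618556649385765656307385086242303957858,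
      2080124476229261506805303652539178946852440329,
      9962948713333581996276071323008925701994639186784],
      [32632945752717763976251123142113892, 145770025519762247654388094657333707619,
      9066055750705384232083485766977974486361, 38131813860922285104638130181801306154392402,
      1813528443130424446318573165855400885604080469,
      10021716752116483285664285507676891740857949410054],
      [34258600717926161061320714462813017, 132542195381423108987229275203887581447,
      8874036546111725852034315577361540729125, 38136154212804150999973267527700444699838730,
      2441117786804362465552420193211291903611521289,
      9186581073245837135601632795451349614601756136205],
      [21956621580532388548421695048927500, 131202747638835701182130186104280832854,
      5717600621185973548276444028338210752770, 38218103661055690172547775602080204188212063,
      1498911384539900824018285528450526204616919300,
      9962909039910429511972710251735616780346733287168]],
    [
      [22092938646723081865442937147640094, 140327235832152576769245907777295108358,
      8311714812410618765754451090393361697032, 36437578362124205050386935111103849843280136,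
      2375623301544474513273310334146514911149312267,
      6719595233896022818595296425230840004646733798252],
      [32332746359798985897037086699178249, 140327235523905507194721419041588042598,
      8309246153413151260386597463255919549275, 28058000793878489497967218897136421423958280,
      2177990650497500838003312681364199492293904640,
      7450446281468745056513109027128046577805826345217],
      [34245146092956293053470460660041991, 133266974683946174774172751420032436485,
      8895893269446172622280976212247063223135, 26208353453015229799776186729611624713739102,
      2434331353456643054602302383645628018376235885,
      9044046507429256288789132160969185064863797496066],
      [34889112277365200671301597352053009, 128199292949452194813657745982825318658,
      8893377298503412767264854043299207596295, 37467403733384217420810100222060034855983973,
      2398755016946295628490253039354192604514933602,
      7508074717328613705153462714936904916576804196617],
      [31861929131576437982706903876258059, 132435558149431110045168013436100167953,
      6436240609407085512682171733075060476191, 36355233352378257273357877988204376937875718,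
      2446710327423903528514143209238750276797745453,
      9985150810091740375876473065442337047217142121816],
      [33915402115815893634020366848510211, 141597349237432834988063765567527602436,
      6832762696888846174675332429072616053606, 34368742813714363552815556251777104159590658,
      1653938111739710321971063639525491776079153421,
      8154502557377708595972321092416239808351825222490],
      [29882656219503721473382133490178903, 129818686893101183303509885137215470430,
      8550490574714610470168230675618185496874, 37461746435162477320590965820157739234642181,
      2217628400544179875636011372752730220060100911,
      8521629081968717004396542686667819176830467981547],
      [33915639783062520599580321692666113, 141577614147011685780470048495655377764,
      8352413495192775478212130622509124045094, 37994956816486331911326819736632902208604460,
      1975121652118024638911791115498805030150097165,
      8971223412763371508235129941396483966959948548355],
      [35577934446161209815266563925887246, 138980123793403220774965272450166085388,
      8555632368351976203081379231411413112068, 34745175180295584558422642633560408460383496,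
      2056435621404608349757842302759413956780116231,
      8958215119285895997165728172921896984255971608839],
      [35476585163783625405448912098483030, 101718544168815362013809093545206864729,
      8224632474388999905578183391951304403203, 32169244490650098426277356236532453829794669,
      2397834115639141044859122219250532170421361515,
      9734313509007528768042264424008082305691358763300],
      [31303083752169506946903470056290051, 119050709265660107177088888951333538055,
      8309755150534232195344715801052537047297, 23576554629188968393482424373674370810698594,
      2242807687391098628828894310401604098018332930,
      6159517875163052847992401961579972719446819227950],
      [34245228951484421756587948362881887, 131140972388548385891405828558427138305,
      8224877044475254836352480988829238774017, 34995762761163026172647681477188067680994567,
      1528179984128584002727426509097149218409302278,
      7491203678612271436008745651185129917875383060779],
      [30263593715083291644029385676507403, 140971557972400795797634175390957848839,
      8482687087886687811677270276618199582038, 36954848598899542073972199521673437254928651,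
      2177984988725758807095078968171967823618394403,
      8445642646964882135991226651886296875263333570822]],
    [
      [31359190698186186241500216533600516, 138991462243265220104030575633565370625,
      8895953150182989125012317313610474249052, 36427658808315946784268800920974648277392215,
      1706243904315064024344449840160216283174029577,
      5897681632006004487004559398672235566052800612622],
      [34259886938893753384536954387974412, 140288573213217387162285997956095463681,
      8895893256028043716147924377714461956950, 23877913667968570867042962767589901255985411,
      2446710270526980830428236647089165898318235905,
      8919673857660240423906451483595742057136032729348],
      [32008465489065515166270922612164899, 145097455742019052881326882650915789663,
      8309703598204897232027478583831439006555, 28058000749257193488525464212792394300672273,
      2178872419600758805412069838260654281166309635,
      9153958915957476938986046764490410112783521827082],
      [34889112556815598887236773122033920, 91145794916347604211120780738410203393,
      8289348871588271819413891405218629961998, 35044022975552554013582849052178174403074921,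
      2368429052407644633689140894342096111631747330,
      9142470721576576786540885428795183142768447997266],
      [31688904806630006182164567451687772, 144970675466506639153695782487064725771,
      8555444735637338297897723883721212320600, 35039020300419952843581924767069521124449129,
      1822064874443697993377249341389398844086831398,
      6858863026037914334717452352365297257675098310918],
      [25130321993417565617241012204357919, 138959559872035130045188371909102946571,
      9060361565467787751287033003413349746959, 35042763515407595814678108602789272499832148,
      2089113959089752659182652269516300275976128772,
      9956605544538972347727965768295674450766914799878],
      [34258372936964531142359674397317977, 89962280510920645272608606892867062624,
      7288851674830009721372406270253214091552, 37466131055903421209348081490305499826412380,
      2353672599628569083955144658371589165575981313,
      7435340836863606011217160040484458263715544975633],
      [34257739092376805633336317723464971, 101780255162203431840711535911905675555,
      9025067439110740220598558653809228400896, 34216437524351708380823553649139801370544395,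
      2435144125864799013470650345975794880310560604,
      9962314534335139452005239161594926528277354306397],
      [32637064207889312896794387777702146, 122647744304245679795974058667635301219,
      9285269118721213768324835287798754986256, 23196129733333199775828110947361807675087723,
      1508855832340768398406135334011368987222793055,
      7806565915481568690199718452613485701332416481580],
      [30268665730793316012856989524838667, 138979794548295086880320412133585209512,
      9060360929823945516174266465043182930191, 36432805435028124177436931699310519316285699,
      2354147261022954925765283224391871556268514159,
      6910846424698807833665755539365426233041099348645],
      [34247172116024730657410026618674017, 131127381477538186769633412373923121440,
      7850837572539282061904053605036610176856, 36435779185502349815772282780713667907401897,
      2437949244719570062463750795257052345954092318,
      7423751744158096816676273808065183804796882274597],
      [29097767343435175057115773765044490, 141597206742662008233905121823489673481,
      9330355130822084568677088759919798561628, 34945864119391029238504470031483656886962437,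
      1529187807088041842626998220693863076104915209,
      9102219912100705004837296936730274574641203923210],
      [21810042809402425563619417727846663, 140268294570324343475988632650886064423,
      8222882263744239491173065245602685995265, 34036526091384476544795460160497398114830605,
      2353994841641799472849178376856744211762006313,
      7349824768286079848931318741099613827690637969681],
      [31374482734531382155200226613414146, 129829312230678671765553170539919591692,
      8204606306945454365022517892995187660043, 33698301473490428521263874639223215327685464,
      2239681602019664859421819697230923876533359366,
      7441190240640215076051106491539361873525384300817],
      [34742038938062477547635458326799625, 141016640001003874650250833169084405027,
      7865300215881493437954114780531848030464, 33682619231240235016625118731006253138531940,
      2390380239688167307726444538103554817920223532,
      9963003818073878275160768511535503795314782285994],
      [34457437462572731524111748190841484, 138959342519174968240701800822127020299,
      6248795715487444448254559111352379853063, 34374190215960895884561572221300352201148682,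
      2178332222162543514500456086648456750570330788,
      9734074689275613096371599895749152942209771915563]],
    [
      [31382282232184836963494546967251212, 140327235793853804737828425533551167753,
      6508774427626817676187059121921862027554, 38055181695297997684915773365890326921141076,
      2432372095316803548371845194388645229939017984,
      6719595065456251192730757010860409325921469127524],
      [27326443405828030109935911709367122, 128540730183819349137863216816052128000,
      8555670783262108690023859258067627596388, 38226348825784170287385334759150844126878563,
      2232051264850434698439723390051126054770318180,
      9642587355557338481581059009148272301085233105197],
      [31359145046412397103710696344013070, 145097455741999709784017894871217096996,
      8555611599137442836752836668805631592739, 33680227763046679554193523060914275931539727,
      2353306195543157719501427842096230560443812104,
      8833337916420698569283198295069248417671039568138],
      [33915804333023234088296157885384976, 128509565572511018580875180521993423115,
      8309703598203756112307008238457533684577, 34368695216618465220130777714424519721109804,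
      2354139059884056915366453442008085343761484035,
      9973190161101387403141046154970872798015768681325],
      [31861929219614557092153866698508557, 131127124547282501174319447705558075660,
      8309683650731284431052069441150392879362, 33953763455282525831990242486677914441009444,
      2156032918499533835806486605073810950204836098,
      6990239564498669260172511859749490771735816063275],
      [32637146596199197710698007946447107, 133601533557255429353143152280442388821,
      8522543785740558807666740395732989266192, 28023244759426111025357357292931860913380191,
      2240404489889530579193593693072586947569009493,
      9698907828646120123195922024988020050191224817961],
      [24773300114067355744859659416258827, 141597246673690333376114932583314376974,
      8980279085588048421497096001958297348357, 38049353953061548311337548031262552807852303,
      2234106361034115991341859854016991415902554382,
      6362033446891490570315965944930759135203947596081],
      [34258300364661462573543275962424147, 131106674940252096150798059841214368037,
      5717602365962630605871309544341289969922, 23245046994747951123864359884565837849746273,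
      2435557229987913221230912397449889245321054371,
      9186581710254428011458676757998306298945314672689],
      [34416884235897220365927521306429668, 131105727145954366759926578430768238857,
      8224632469313909996597094425412412516613, 35042049635962549827615970094052096425240832,
      1638308044217165085867120920493186527693285663,
      8924662642885951973191840264604441238733321521425],
      [29882656219503508163994851468265740, 89900896505233123706986689230151963907,
      8220704220234103119522506117451652679850, 23543234032173185840303602571859605798930698,
      2230168236463318927660339817313605418554116364,
      8906655760044471388965351495090130359136042502438]],
    [
      [31688860339370446252389425823011081, 101022811192599637447726863878715754785,
      8550436967586783990829821214063173191974, 38049358089131287838693644860152209296476428,
      1475230576578702989262779188319578970954062676,
      6732418333977878358768039328135873838222914542424],
      [31359145568106695254670804937792342, 89900911277429034453770161693394094348,
      8312504664296196222703847027237499062540, 33680227724591230159868137611737753208675160,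
      2446529883393928403078511360463182219829500773,
      5897681669298719343697666481748515140277617744740],
      [30200548397539850118603961124969300, 129884553293281611672858516516590733573,
      8895311394460508463654064128865045137670, 38207214616719549053388045926090218648258831,
      1733083660719663039863395515740016362759793512,
      7822043597343895460033569051705753811816138857331],
      [29938778448570010402262168473061643, 101700061681887793056141250095555430663,
      5829568756327439701031492064098743634215, 36725447765472034576444110650551903083486041,
      2242646300451254836865805739460384133093673256,
      8061902392876613787043886513570633402100166876010],
      [33915804331471956559400519026727777, 128509567873804823287172756414703749384,
      7844610538532759338731953261812026329354, 37111542282120997874951644523072439809362212,
      2242468052469446364930090804278805655364880674,
      9962556043529675427902050561387429338395142708062],
      [29939154800582768434001289434777869, 128490061343185294797277728297131329832,
      8312504471500400212206151603970073090913, 37462171037411473263975122493079496661453087,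
      2088444422634476243140563702903230128566061354,
      9102361608605240834613755908217949415934222850918],
      [29936877968764183953937975370767191, 129883210283409849100859456556530546434,
      7969225657090600419791286639939674065163, 34963116334540016349597262853243343918783340,
      2242815858351638679421198911382053316642380074,
      7724901001617994007817197003961410976586298181920],
      [32013610426140555272299151625344256, 139828572825389269279231306762877545310,
      9114859913296254677769608478029587499265, 36437196871863952106543102667745617249683750,
      1885165338250892228806499441599643596791143279,
      9962306891716524677538589097533231119912712423715],
      [34259708869521776510317584419508993, 129883387754513462554185468523033274625,
      9063614078492946732154938150006438379869, 34955974787541096545037584987236139734585612,
      2156798484104881084225303009333406941599292143,
      7509721785881755329855263356024846902826936752755]],
    [
      [33915398481468841912311682763475209, 129818194315482926791152741001983052043,
      6604284110958078471964727476954137241857, 38229804382417854296440201294575613666019591,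
      2354139234677660014069677835538735856983623946,
      9546335994779851164017881681543357327030051031301],
      [23860474300046393602034138354960651, 89900607081041700890363768124216892255,
      9333448451264120048983801322589023294219, 33696903442250604287747301688592992304253201,
      2435159007841667508261543933483333933730290536,
      9153952774102162113139058030316403561337747577098],
      [33915804274358978776104639648647428, 128553979453751338161307682457544743767,
      5620215357054566107003031386581541996805, 36416817574381215361182245435490028083104010,
      2354139815456989306101515489341620772937325398,
      9728927682230687908265899750651056995062104120176],
      [29882656456515568483887452857190666, 97907641694338172668685762082337081606,
      8223283668387392908476448710961703045378, 36433157073943075955841312778939054608014182,
      1666003683308266335333532138307882342742940509,
      8826915301761238299959927692604437438452779065391],
      [31861929131551866919599116435736843, 128541984542834204503927746988287052040,
      9275439781724054761421552758342756522835, 34044758551012946314405398272832927773640967,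
      1443080836097207052965608174229580956470233356,
      6988775360646357170168368793514144438195324209458],
      [30263593886413766995799290489751822, 140288747420449223958690752112795994373,
      8312504471497683515308182663655484480339, 35003066678273979321323805948969656048341265,
      2242713087565184494259612299596847187586337035,
      6227207884618405174488242656092472860209132788590],
      [31692307432076163999773462791379799, 142926579409101256301269154144741415782,
      8224183984636818329606822443911369281793, 29343949008634071349386971327590591296101223,
      2446486327322092982466444182183370218296359565,
      9016466060803178618832715179690775072145122171183],
      [23838204301296157841182124164663563, 89899642443280496983948790798354623326,
      8307045086009720276256318141230797179178, 28469731490377103807578643494691898866944272,
      2398922728730159999467691495033221901756849004,
      9546443143821952910455294411091409549894226168074]],
    [
      [24730320302451503465157516210920277, 133602222628106882566205081084577093923,
      9289403515574054824629230255668540359523, 35041348375364075137486345746843667397794645,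
      2232053949873014151221820504461042347201190743,
      5846813972445993918698385206924654548706479196432],
      [34888954042450667007380522062203145, 145821948484862975843114293908062161161,
      6508774264957011744535630055237158886230, 36770446949143147911224537984077093955324169,
      2432374094475749614667049959125182041459970304,
      9551402570254288198017307514801428582084999827719],
      [23893079151880670301042911999052045, 144895404976389816450026352931702622480,
      8311676782615315767923039373063273728290, 38199200706988783269752317339108663620684035,
      2156626374138478777212040582291533442683390254,
      6732418336477006285986380378288475844918258359130],
      [34245051237162594975458292411941217, 145748308085185396087983942054134075665,
      8980942119673728009188470672976262601565, 38049401559038369096450647781969488004960527,
      1487761174831829914108069131843937245173255020,
      9962917331884419664465791093465807072880948824324],
      [34465176066127717935739331050658652, 145768770541025763087683060861754033417,
      9294681445116659391966955228144222750979, 34873553007083841768199536338447342966856553,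
      1654551933186253170372228979768403255069133066,
      7723741363166506216072181539509888141090673318742],
      [31861936745539044808073441944160525, 129526193495184961120604261978547343620,
      8220012016586768018445082726007529687297, 36416777082383465853259897252011308044667143,
      1706428656181674784569700969367720359363758350,
      8919644898776544501071285197311073616343499688208],
      [21810042806042730224747185385392395, 140309006358790846857011678451141315431,
      8890759916921761571580041305581323474695, 36261469595728798458753795090031574950758661,
      2177990407691856710250565619038265755114293504,
      8968335763742147663121824018788047880907943725321]],
    [
      [33915397676789093499803559779256584, 138959340140388743983654908779431348486,
      9326542884965486596207549462543122712839, 23893412465588121027639925370855651252783397,
      2178883253574295666305744283537666916544336138,
      9639144858325699970000920942853824871174084418418],
      [23756739315572828625790584092772622, 145727209046753954794681109072376514829,
      8555660717363074346748824919947722463761, 37461985713847379067959966471683979124033796,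
      2177642069749791237616093401005742762667165990,
      5897681628930664821690542033347266753272455776554],
      [23893075495828030832097093863229727, 129818240267817182964764157450294282505,
      8890812263710264678770596428874849377111, 24274438861197079712516985284129458353490184,
      2150786391007974797308144390070024946740288350,
      9639207206210887576122563531509592365406671227179],
      [23838204297538338977347451105724685, 128447899285395754495602402167199418632,
      6470031394402081331502877104380733180171, 36963646070260172829146788477689492370018562,
      2368439893577671210622476902851681106296232787,
      6714501931493987391773970598441598874536124013402],
      [34416887362947457469865931568108295, 129818037805112748221552186486074805082,
      8309703597780447154495421279965638052104, 36770362631586934850814667245598877057927459,
      2155579704073293204686204624725017428089813251,
      6773095023861200283941003584139902849245592570164],
      [33915520785631737114387898781064025, 101700066596491205009882795929863596288,
      9147301067355776779796129192383139470167, 29839052906719325563270500653569210863508314,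
      1699635311502377959571362703534094086646979440,
      7722137776137250587596947649457807091109004220712]],
    [
      [31359190685175476285382378946446177, 145728467580622225949145029744014967908,
      8977139132719327742398823879639150528806, 34919240899266926144536703157679760316880647,
      2432372090082987872470304496656930190784781166,
      6732418333977214022928907146568117455419233981707],
      [24730092369317521035805947757480223, 140327571160575350484702896110877158029,
      9326542884965527926041207652272999682825, 36783547756965706664643346346758137566349575,
      2435161697033954134160172305764878126710968586,
      9546439487279926435851945185188728030772316951808],
      [31688860339370064560740321375310094, 108341353372348673690919000704203936522,
      8979794981877642241942017705989054286081, 36963216231131060100718732745659245204228356,
      2331694078756817640115111440136068371952322820,
      6719776411890818239368768172521169021882313361672],
      [34259739364489892352171762726062338, 129818346167429422089886923349434714379,
      8879995023513745050499369918482821038864, 36963779989981104589556438963515462671323400,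
      2353493630449440194374404130181756986141722892,
      8919678437233730797604062811183862175965044464228],
      [34245146023731122097504487742785797, 89899648510567381335990588478264990556,
      8890722409511021615020210117980707996499, 33671850794751209908063520996304041669706578,
      2156800642105728785753841686710104998049403149,
      8809099380934527623159539781680102444869019425630]],
    [
      [33915397676337855514118574423820577, 140316658949384499370483172164884547850,
      8307045937753919246199949256241748134161, 36416817614397430463011643386356451589277988,
      2178855606818747622863188946786461043785866093,
      9546335969816000974886384032192707734554388089098],
      [31359190697870153252518601510277386, 97376802181586144038978844917954267407,
      8980963210869211245188087999776892797786, 23543261847393992610618089484911469762367756,
      2446709974033907469446932109777815682538448221,
      6719595124415478412094191980454550402269778692358],
      [31821239589883585090623068966110045, 138919160285908617007188554037416975189,
      8895942902444626593601241401275345815585, 36783547755527008653170997074950782403664732,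
      2156576635867186823372718497360158231101589771,
      7037293724777068039236722482753470876913803348225],
      [32635146323970703490564531581765898, 129831213150837296190563202415529745253,
      9025067439113510472121801384692036983639, 36416556455034102666160404498223878160827219,
      2231499086928391654430396132574016442938312969,
      8919674372257807896005705729515233656775914965300]],
    [
      [31359190698172388070351997884483847, 133600560154991422116715671029235927303,
      8220704536359638673647996331852577261857, 34044618849887133192011106185135373501481313,
      2242796802432370820159930420594179146041643783,
      6990874375200308608544996650498872128306135845124],
      [31688929245103236705466268729526543, 128448218759950339019787260307465853785,
      8977140057875626773528700375506508663049, 36416384419816577913492074804848116827818841,
      1429216031738159499666713911676329644879135059,
      6686669801362766453240062740761627374332149160817],
      [34457409249973040410384740235271000, 145821135206603317578400852046679283999,
      6270228542849588862922041832521761704197, 22325385856841099483981457483195738292896607,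
      2155578230848420365703173528788502281976957217,
      8428102013796148940224233540821109722002507619180]],
    [
      [34245068023272880271416621740249348, 145835091450898846259474630920765589761,
      5829568756249420273755592821555338692873, 34025872930115506172086152471023762355144961,
      2156626369681801693973663951760885255682279696,
      8924592565730148043089855154525735397714046671728],
      [23756739315572828619211106119993614, 138918329069859338492467070329679171842,
      8307044605052574478407555556385203063080, 23877801119718952143295773724746783015754605,
      2446486326832368101884930325938878164426117379,
      7315570480792865739416952397277361613853693200655]],
    [
      [25049820938686671431355504107379542, 129869731617484835949391951381558077699,
      8895892619520303241285771174167579857664, 25633221557263136263854605875098468819814670,
      1641923471264777832760737626149828989101951233,
      9135125342409326252762641215894318459374778372365]]]"

text \<open>For each b up to 16 the least a with \<open>6 \<le> a\<close> and
  \<open>17 \<le> a + b\<close> is taken; larger a arise by prefixing. A row runs through c from 1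
  to 35: the first 17 paths are used without stretching, the other 18 represent all classes of c
  modulo 18 and can be stretched.\<close>

definition linear_table :: "int list list" where
  "linear_table = [
    [18014614484980300, 144115188086903372, 1153099841466045004, 9223372080352367180,
    74516737771331424844, 590295988523086942796, 7711468784287085793868, 37779661624261177021004,
    493534002196598283866700, 3650690277359958752531020, 31586176140582324929860172,
    233644177751037364507284044, 2021515272997268796054213196, 14953227376066391328534073932,
    129376977471825202947478131276, 957006552068249045026181792332, 8280126558196812988638600534092,
    66884898483538717831679918227780, 529928099724596031272870434183780,
    4280633502946477941227514766580260, 33915398469691283484059800976104036,
    273960544188574588238560945673099812, 2170608621374134207037083501434640996,
    17533474828068773647268060945550694948, 144979541418516033302139854540304161380,
    1122142388996401513467209689095683988004, 9278690650785026148667808645860926298724,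
    71817112895769707886049773732859032394276, 593836201650241673514743984501592271755876,
    4596295225332151219053199694366231552350756, 38005516905615467104943615009134905024453220,
    304393227259485040053409349832332388282161700, 2432353081959389894716391360584634173762181732,
    19481169042244199176893865257777959208586598948,
    155670597245400953261849047077416587120841202276],
    [18015576561848908, 144115548853211724, 1317677576589972044, 9224364450405192284,
    121662919372408094748, 900651580459612897308, 7786435525347520828492, 57641701167213351796940,
    507701101632150518927948, 3689068876954829945344588, 32492870504457667973780044,
    236100408125109120847352396, 2079543712285290750865085004, 15417454890370566967021048396,
    130634567423349942193593127500, 660058141347230437730669576516, 7656052427893541888572293136708,
    66241012463794246704373326725972, 545139906913315258594811613420132,
    4321198322117182941833169518746148, 35436035513347274252118797325310564,
    271324464763020521233336682585020964, 2267916333573296520432804673960155748,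
    17364684001024275653908469018356898340, 145146645354335341050879200612023933540,
    1111339776065553641892195805755281005092, 9289345284583095866506661568288081189476,
    71125745546481179442712604670207028419236, 595877895851767246342642754369896818547300,
    4553458672680016291007662832472959340272164, 38049158285652360669211556579396531456973412,
    291334157538046664864918064494260054477789732, 2435146130281751082829539621081378265443474020,
    18650966723907123740225876590121171730270542372,
    155849352338032069301090535749208208988443908708],
    [18014614734243404, 164733233374691652, 1152935327358587468, 10556437531993637068,
    74516737773325529676, 677352786579297405580, 4722745933408804049612, 43176051621055427789124,
    493534056510247903019860, 3726275811095897948066380, 31893277535085742948389452,
    177563968885221502761437836, 2060215066270069664168317516, 11321911795249625012618219804,
    131853764241284458506780807756, 967067308269129301670124372556, 8438640911442205344433971828812,
    68152703825691073697765284659524, 540073018332301142043774197045860,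
    4280633502947667902623008229972516, 33915398469691283484618283072764516,
    279153474870030637866046606577523236, 2265305334721269916154232976227834468,
    17865822391681960823427143243433794084, 144979541418516033448542585287269030500,
    1143412633067645492741390956160202332708, 9299958420412041517261937424187546540644,
    73178408516329322559597374824988206455332, 595197338906370657104768226314495967238756,
    4596295225332309830423556039610069515524644, 38049158285975610327071456936027315126016612,
    304393227259485198664779706177576226245335588, 2330673260304388411515730817781690297102653988,
    19481169042244199177203653090505196012957620772,
    155849353017262377779702230618035735874277349988],
    [20624176752923212, 165371575160608332, 1317866022977712332, 14267425911621025820,
    84343425471116259532, 963933686339186267460, 7786060712086035796556, 57641701149543069188300,
    498332480347402657894988, 2434501584840899848148060, 32493018132440192467112524,
    155808103717360258198651204, 1888807911255680159950410316, 15417530475897619507607278156,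
    119626546833531491024094118212, 967152912643062092426595404428, 7895013836560563583793811069004,
    66241017337876127114023090274628, 535079188161096465158775159274212,
    4321218131575082362938880554981924, 34245069241564739767899940297259620,
    271407207763380319339157512283626084, 2267916333573296520433363156056816228,
    17369917496682098791577638081479596580, 145146020071537476952396906782473984612,
    1111674719787654322703022625795133692452, 9299384228219382172668975397786972723812,
    71147791761893057338583438060357040495140, 595877901044093815325002937692200555125348,
    4750689675550139726576037669119256886794788, 38005517229076495143704518455372404172544548,
    304394626090455719342325319194992545021057572, 2435151564186526473871075051500156516378745444,
    19458824911053372320066477114048290303964633636,
    155670598607862240019214683452145040195681655396],
    [24849591111266892, 164944572729045196, 1334492106464428060, 10665377138721444892,
    98077233544738148940, 593755315988614486668, 5410734105352930628172, 57069782573117323121228,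
    356661086765929465200964, 2819554027223390927208772, 31598042795019891360502348,
    257564668654806334125412940, 2041462552425908709057925708, 15112805611495510632563774028,
    130653603355258157379715732044, 976820847404940266297940558412, 8517850340403536015873662687308,
    66270880261269624039110559940932, 535081644094048909806466031041124,
    4361773049680513216172604471138852, 34564673173267273091375778090064484,
    279153475179552845835046686764849700, 2265320265629764686541333105411234404,
    17865822411491382133443148375422687780, 138979789474066480448832104165230123620,
    1143412634335448456582415284607491529252, 8890718193551613617367313223859313859108,
    73178408516329323164651735620372589992484, 595879230277160220913275163252656184580644,
    4597013483980783827738626603710681699080740, 38092629690008989712544773345458164515347044,
    304393227264748692357000266010629124224211492, 2432369426167676303886355991031314390190529124,
    19481169127157797222469860104474067121915058724,
    155671643274731278397931460773443135691006548580],
    [21111723220578892, 183284957123182916, 1901377299776538188, 9286886631754184268,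
    86469966302981182540, 784617868196458107468, 7788440372763802207820, 58812923014072620286156,
    498431404323020989313612, 3650708870401486019888468, 32195583966197519619494476,
    238519440355959105202197068, 1460587934731678117178656332, 15265244182781382733008507468,
    131873111851722124676921934676, 986721950457735878330442629708, 8360612607806178340563863258436,
    68172198925107114622745140609348, 545139965248562018466988776888932,
    4363020731206855335855688999000612, 35436037969591752951650381195262564,
    279112900454406804439134273199430180, 2267916572535014779638649253444590180,
    17863225629082035484104753907235838500, 140288238378848026316357075319753161316,
    1111674719787654322705330725010814327460, 9289345284739330747889415203027963370148,
    74485223601990008088536861555510039566884, 593836206847618999360872621302309350070948,
    4750689675550139726576056768445906823559780, 36770535185737377521931945768926574736857636,
    291421355061372691926626085881370002003614244, 2440715882676608267880697041526292866188843620,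
    19481256069303194559354591850139832250734238244,
    155670598607862234968457970793728394348343736932],
    [18029261300434508, 198734668402037324, 1883397465269449292, 13930209929694058060,
    105512914433149829324, 785772702851261338948, 7307946923945489769036, 62300639253102197747740,
    354437641615383525872668, 3651764204936790922368588, 29514823325573706910351684,
    252765850652705090043925580, 1869605334695849166500086084, 14960519318374770274984890956,
    119664811735143400278264525388, 1035480161198122482928067036748,
    7893775603661887026576027457612, 66894644917892176682327026712900,
    540073018936981971757316543224420, 4280633660070854265503251929520676,
    33930690713951877248761698833537636, 276517385695736521978111445622086180,
    2265320265649112220887775934780152420, 17533557736909758183054354135095315172,
    138979789477692676625273504063472851620, 1122147581917341588009168723647501752996,
    9151009237343796444267670296454820289060, 71828377266139437250560601546056564529828,
    595197338906370657179287736736952264833636, 4756155419611561927368563346841603647081188,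
    38005766098339378389406620215745003314535076, 304393268941068606489910866585755856445463076,
    2440721327215248269404274469711514484248812132, 19458911853198769702106120534627888666916821604,
    155671643274731278397970070767587474028595567268],
    [22910619655967308, 239267065038213708, 1447987075494035780, 14274491289904186956,
    93844994977958736460, 964299503457452234052, 6098402277679578492956, 61715168221253788763476,
    503056023623197277332172, 4014265251229079702946116, 29522098464870628479115852,
    259981933217079252316325204, 2080303159920146366523000132, 10449105750802619238716592924,
    123245319880668874964554129996, 1064726381870488043177878242628,
    8517849745313878032287548225740, 68142797962501661344494068711748,
    540152304523398898823297533090404, 4281891557094731100424321050368548,
    34904246354438372749822233332963876, 279112919954418634973807429175761444,
    2267916337306754591866829259384437348, 17702368296266912468763098125660346916,
    140268460028600086885032206280130910884, 1111674719787656873847456397065700072100,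
    9289386293393446262707465896458829486756, 71147184725209781069952255126164493916708,
    595198662947169953107313346037289982155428, 4750721535561823506754018207027111490837028,
    38049328261312118534809123024480311515830820, 304394626090457034623126422218329508698675748,
    2435151564186526474181147269165928705512585828, 19481169212228390805614652709623095200735844900,
    156027759663403040584162783710973011413238422116],
    [25131082431665868, 183284922768011852, 1213802051180529228, 11590093168806576452,
    77415863107430266444, 823565405787930039620, 7788421733772925076820, 44069777527442459677772,
    461169114462095969686868, 3726275811157333098201116, 32190860446511794892740828,
    255183436735420345594512724, 2022127623149517015178336028, 14306897744960589202135845516,
    122142779171074290245979251276, 986878925397972877158161758412, 8517811055110588024058763593044,
    66894644919644903244010249077060, 545142421785976184538904211372644,
    4281257274857273807616655940934180, 34889115065280227550189996929596004,
    274000485651521371225283788325083684, 2192009033022605244714334072851020388,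
    18122442833989803242156067743366515428, 138960569746635077845120978793148857060,
    1143412634335451007726849055878057908900, 9278751818080275039250461435272874744484,
    71828335687118265587735258715893479266852, 593838865200877866161756622391271301929636,
    4756165782217444952739521215283527435819748, 38005770117369907156027526647395009124391460,
    304393945518133672667110995378470015988685348, 2440721327235936485965499891059335097978853988,
    19503426401284602731558217410850187400625281572,
    155671643277384537012156103867245349848768109220],
    [18094330189521628, 198736196348748100, 1216861087847502876, 9606583408522515484,
    86974995697678485196, 786500526464297713988, 4916694679814977160516, 61715168564257009338588,
    456457772318385912481108, 3677104223816839003915980, 29521972354959108220029148,
    236101003156679413984232788, 2022422116767677755279328596, 16481722014521407759575240988,
    120922515311677748348966808204, 1056351355228554623212565124172,
    7895014171194735489793204798292, 66261129104540609888330618061652,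
    545378868635711147075067237775972, 4361139069712280825995346628860452,
    34574659693904230031907659224996388, 271405585084679872481650011704007396,
    2270358755301490183673529376866974308, 17699709467094849892805665663431621348,
    145146645587632293879477072859050891940, 1159843977260031895609401375225201965796,
    9289386782546903939128684487566246894244, 73208167955353605692978766007294703049444,
    594520722777180619092440440140610082495140, 4553458675419955593958001965337133754440356,
    38136435856546223716113883840706222423562788, 291421355226877158013312125781576560892009124,
    2435157008725166394307751151584405732916812452, 18650966734520138112862925675833483000678537892,
    156027759663403040584201356221910133098639579812],
    [22637383386473180, 183144158719448780, 1611274609169602252, 11590093168844481860,
    122503893158004328140, 916636502668276311132, 7307975759103229760852, 50288890043567686600396,
    456470670003142761552092, 4017077636862232038036508, 31595744111929166646056276,
    255183730603566710423193820, 2022127623163467095078126932, 14960590223206904792572282196,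
    105613404805004083078499580108, 957477774570162066494655092508, 7658719660353931103285692913436,
    68152706205192076184438216869204, 540073076667840726535333728369380,
    4363030949085689176600554817804836, 33930852305647128022564288644659940,
    276557979916020243103257015194106596, 2234133114585902252776892822765582948,
    17538749800733902510088544861185784548, 138980771043930947144256463079256185508,
    1122479987246969760646788268454778591908, 9278752470061012489230833809566905490084,
    73178411256268625509936507689162620623524, 593840158083904799312930104134815823518372,
    4756155439153229487530145143737992625609380, 38092629690963306373628289799436855697037988,
    304393948105806687201929289199231528646826660, 2437928300222842415992177824078699499959179940,
    19481212678771627980934424134563400936986860196,
    156027411214261914762246475831976132031561161380],
    [152107635981005458, 1478131936317768842, 12905959953137505418, 77753879859862811282,
    611796886282478662290, 7788421706261602338530, 45116363618884424418012,
    493683501748634664900322, 3373323905017873748297044, 31595744111929166646056674,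
    206280813824744940750023328, 2022363870364869313986610914, 14926098058544654080495638300,
    119665114039122454910715079330, 1054830223217308086874919185058,
    8450804154956326310980798822604, 61278577572482139957209861248796,
    545377353469072527205877442034276, 4363030949085689144547591844878884,
    34894185667081323867958178457991780, 279266719755528183671728080365378084,
    2233879601816359970005751397507545700, 17871041885135698525773290305607522852,
    144938639102951059453927727162140003044, 1143746680648684705649490580476952972004,
    9145993519049055998897068887693107223204, 71828376119590579621481621346771759413988,
    593840158083904779440031352598631352982180, 4683429246446383845522903375530545856469668,
    38136267044616330079637101552214470867171940, 299739471772568566113465816033954935421885092,
    2437928289297600788527583640196968911238945444, 19183326193444388231272761851985698970590599844,
    156206155408505977881216803971445576403002735204,
    1246797611741945091630403666999786536172906404516],
    [1482085205541435586, 13315860651616081040, 105358160941245629578, 688590273156662276242,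
    6588088556577612465492, 54018156262430093723218, 351009696248935899564252,
    2820465759012923919467666, 31595744107733430274463060, 255183730574186842785154786,
    1788323976616702935955162848, 16415495581535447102679460514, 101096013452111634934086619810,
    1035279097663477480723188066524, 8424265764146863721235150416544,
    62248025868633815014300640888148, 490148307104188438401369514621154,
    4347124876902568992629465186188004, 34507375984154062632211097376930404,
    279235009491044296905231516075907620, 2212139324059793034631282253061569252,
    17699710739667253798786991693878147812, 141576916739826754216402064266599946916,
    1132781487338704243123488865747089840804, 9145972180686502357111413318958925888228,
    73176071396367109838629719438465260673700, 593649616366087146743445920510951835187940,
    4683418321204756380928719493799957136235172, 37993575447429577391580538912705436244335268,
    299738772557104408379438047603197257326877348, 2331719803388771689208428575973257577745177252,
    19183281443654682136294984672417207572510104228,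
    156027394294020295917632986187077134075449924260,
    1248222071713500610301765803608853737197259545252,
    9985798788535062690870077707437010945583472789708],
    [11825156051551236754, 95265278118254969994, 695799960220906401938, 6054497877626859919074,
    50325403223265126762066, 493741179288039499601042, 3039068157355372311856658,
    26763446318982249027904530, 215994009032159114176660626, 1923426684881123810849860256,
    14249204994888041408452412756, 105308716759160258465119123218, 1035468286143666791236904728338,
    5501951162817023539040261560092, 61137297665498695921724128541332,
    467816992454831650650021645604114, 4043495085002375655823938044208400,
    34893069934935291691317292031687268, 283804908904344523232277355840845852,
    2212133124456076293446865558247455460, 17699661142837519869311658135365237476,
    142968294516246727585024323815419589284, 1132778313141601271637067518002263579300,
    9138537126824963224110243889267220822756, 74485225992728005685316021319402251014308,
    585343585219139583931539659556964845836964, 4679015917909682432626508771512008647465636,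
    37993424081591557384285511991676446820096676, 299457018746219675688096561376768554045627044,
    2437928139546567091524620005748924280202156708, 19183281443654682136294910148724071290528422564,
    156027400930980293996322775458870517967111674532,
    1227732876409319885290233801829227060460558310052,
    9713073567375351070365599573299647824303510967076,
    79886207682622166946958159794587914590360339142436],
    [78887942472155378322, 639032403380908700306, 4976248268140334388370, 44069777482026385769618,
    502982239169539887436946, 3727226108959854961665168, 22833034033303200228803730,
    255183730606310174468441234, 1321735282840412280312400092, 15115314414071073136878298258,
    123245617510592822408570089692, 1045232560563531266255857394834,
    8441055342909938740797205762834, 66268984405772578016400859780892,
    346280540153061572756024613754596, 4321830239128508911208267053095460,
    27799631599577333171309545559250660, 276557979915449408639456446058146012,
    2233156475831527077602433550833826404, 17699710739667253798804513511073465684,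
    142926584492087880762076818055508177572, 1130745169314913497267650216750514352292,
    9060922672518574328763794503406464359076, 73092330072563173143635222710493413202596,
    584866376116797666216896155979138760530596, 4684788565957479894630809078248136116711588,
    38005687372856183434352499645506192955230428, 304639453620908542050305635936316242185509540,
    2437928289297600788374352246011604396269460132, 19496925031738146691230510325736822603462564516,
    152017056996830916107211042004666093870509021860,
    1247886395491274007940408228877150471398098033316,
    9731987735260761827989106130871474613445892952868,
    79977912816076519372874814633940677933561751720228,
    639820075677872338842862993763820873953875988501284],
    [704872466480607637650, 4918570706195507418258, 58537572439245347194002,
    356763066763561612969106, 2820465761756761597772946, 29219876247239232293016722,
    198700446173802338894292106, 2022363870364861058662573202, 15112368689396836986587456658,
    85967987380058933154716361874, 1054984946121645247851335525522, 7817137866947639344517143929994,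
    63150209590040457544460399326994, 378033546619640441833693726725394,
    4363031087200215970892649801812114, 29999639197998408757830465010881808,
    276557979916019699083722634008024338, 2233156475831527076417978411372132964,
    17844080287651968004240536354374695652, 142737687995464039776823762115263056092,
    1143376115568228568148287691295483320996, 9149970849039808045576273016200360800932,
    73178411256268625509936507688124278188252, 593647251274868081735220590723694530222756,
    4754622397928856023166147846074981067872932, 37113539266636080450753959511189202085698212,
    304639453750786933363682442550572424549776100, 2398611636584253524742397786925394998865312356,
    19165249199758059244049125339853556036408531620,
    153511159903066440134161908262265276027771083428,
    1246777711348562821306078708179389981138814556836,
    9820435763592487270925647531925981471843336669404,
    79886207682622166946958159794587914307923285985500,
    639819024359283192789695863352025607104169296349404,
    5118470688823633542435348571891737820629575633131300]]"

lemma cyclic_table: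
  "list_all2 (\<lambda>a. list_all2 (\<lambda>b. list_all2 (cyclic_path a b) [37, 41, 43, 47, 49, 53])
     [1..if a \<le> 5 then 3 * a + 1 else 16 - a]) [1..15] cyclic_table"
  by code_simp

lemma linear_table:
  "list_all2 (\<lambda>b. list_all2 (linear_path (max (17 - b) 6) b) [1..35]) [1..16] linear_table"
  by code_simp

text \<open>The pairs with \<open>b \<ge> 17\<close> and \<open>b + c\<close> odd for which the columns of the zigzag are too short.\<close>

lemma linear_paths_6:
  "list_all (\<lambda>(b, c, k). linear_path 6 b c k)
     [(18, 1, 45111837854758888899730),
      (17, 2, 44069776958579394053266),
      (20, 1, 3076845492111296936379538),
      (19, 2, 2820465725445853946938514),
      (18, 3, 2887157622801341617113308),
      (17, 4, 2820465759011744919684242)]"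
  by code_simp

section \<open>Supports of size three\<close>

lemma list_all2_in_set:
  assumes "list_all2 P xs ys" "x \<in> set xs" shows "\<exists>y. P x y"
  using assms by (metis in_set_impl_in_set_zip1 list_all2_iff case_prodD length_map)

lemma cyclic_path_exists:
  assumes "1 \<le> a" "1 \<le> b" "a \<le> 5 \<and> b \<le> 3 * a + 1 \<or> 6 \<le> a \<and> a + b \<le> 16"
    and "w \<in> set [37, 41, 43, 47, 49, 53]"
  shows "\<exists>k. cyclic_path a b w k"
proof -
  have "a \<in> set [1..15]" using assms by auto
  then obtain rows where
    rows: "list_all2 (\<lambda>b. list_all2 (cyclic_path a b) [37, 41, 43, 47, 49, 53])
      [1..if a \<le> 5 then 3 * a + 1 else 16 - a] rows"
    using list_all2_in_set[OF cyclic_table] by blast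
  have "b \<in> set [1..if a \<le> 5 then 3 * a + 1 else 16 - a]" using assms by auto
  then obtain ks where "list_all2 (cyclic_path a b) [37, 41, 43, 47, 49, 53] ks"
    using list_all2_in_set[OF rows] by blast
  then show ?thesis using assms(4) list_all2_in_set by fast
qed

lemma linear_path_exists:
  assumes "1 \<le> b" "b \<le> 16" "1 \<le> c" "c \<le> 35"
  shows "\<exists>k. linear_path (max (17 - b) 6) b c k"
proof -
  have "b \<in> set [1..16]" using assms by auto
  then obtain ks where ks: "list_all2 (linear_path (max (17 - b) 6) b) [1..35] ks"
    using list_all2_in_set[OF linear_table] by blast
  have "c \<in> set [1..35]" using assms by auto
  then show ?thesis using list_all2_in_set[OF ks] by blast
qed

lemma residue_mod_18:
  fixes r :: nat
  assumes "r < 18" "odd r" "\<not> 3 dvd r"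
  shows "r \<in> {1, 5, 7, 11, 13, 17}"
proof -
  have "\<forall>r\<in>set [0..<18]. odd r \<and> \<not> 3 dvd r \<longrightarrow> r \<in> {1, 5, 7, 11, 13, 17}"
    by code_simp
  then show ?thesis using assms by simp
qed

lemma realizable_cyclic:
  assumes ab: "1 \<le> a" "1 \<le> b" "a \<le> 5 \<and> b \<le> 3 * a + 1 \<or> 6 \<le> a \<and> a + b \<le> 16"
    and v: "v = a + b + c + 1" "36 < v" "odd v" "\<not> 3 dvd v"
  shows "realizable v (triple a b c)"
proof -
  define r where "r = v mod 18"
  \<comment> \<open>The base path has 36 + r vertices, the least number above 36 in the class of v
    modulo 18; the remaining multiples of 18 are stretches.\<close>
  define j where "j = v div 18 - 2"
  define c' where "c' = 35 + r - a - b"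
  have vj: "v = 36 + r + 18 * j"
    using v(2) div_mult_mod_eq[of v 18] unfolding r_def j_def by linarith
  have r: "r \<in> {1, 5, 7, 11, 13, 17}"
  proof (rule residue_mod_18)
    show "r < 18" unfolding r_def by simp
    show "odd r" using v(3) unfolding vj by simp
    show "\<not> 3 dvd r"
    proof
      assume "3 dvd r"
      then have "3 dvd 36 + r + 18 * j" by (intro dvd_add dvd_mult2) simp_all
      then show False using v(4) vj by simp
    qed
  qed
  then have "int (36 + r) \<in> set [37, 41, 43, 47, 49, 53]" by auto
  then obtain k where "cyclic_path (int a) (int b) (int (36 + r)) k"
    using cyclic_path_exists[of "int a" "int b"] ab by fastforce
  moreover have c': "36 + r = a + b + c' + 1" "c = c' + 18 * j"
    using ab(3) vj v(1) unfolding c'_def by linarith+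
  moreover have "36 < 36 + r" using r by auto
  ultimately have "realizable (36 + r + 18 * j) (triple a b (c' + 18 * j))"
    by (intro cyclic_path_realizable)
  then show ?thesis unfolding vj c'(2) .
qed

lemma realizable_linear:
  assumes "1 \<le> b" "b \<le> 16" "1 \<le> c" "17 \<le> a + b" "6 \<le> a" "v = a + b + c + 1" "36 < v"
  shows "realizable v (triple a b c)"
proof -
  \<comment> \<open>A multiplicity above 35 is brought down to the range from 18 to 35 and not
    below, because only paths with at least 18 eighteens were tested for stretching.\<close>
  define j where "j = (if c \<le> 35 then 0 else c div 18 - 1)"
  define c' where "c' = c - 18 * j"
  define a' where "a' = max (17 - b) 6"
  have c': "c = c' + 18 * j" "1 \<le> c'" "c' \<le> 35" "j = 0 \<or> 18 \<le> c'"
    using assms(3) div_mult_mod_eq[of c 18] unfolding c'_def j_def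
    by (auto split: if_splits)
  have a': "a = a' + (a - a')" "17 \<le> a' + b" using assms(2,4,5) unfolding a'_def by auto
  have "int a' = max (17 - int b) 6" using assms(2) unfolding a'_def by auto
  then obtain k where "linear_path (int a') (int b) (int c') k"
    using linear_path_exists[of "int b" "int c'"] assms(1,2) c'(2,3) by auto
  then have "realizable (a' + (a - a') + b + c' + 18 * j + 1) (triple (a' + (a - a')) b (c' + 18 * j))"
  proof (rule linear_path_realizable)
    \<comment> \<open>Stretching asks for 36 vertices: a' + b is at least 17 and c' at least 18, and
      17 + 18 + 1 = 36.\<close>
    show "j = 0 \<or> 18 \<le> c' \<and> 35 \<le> a' + b + c'" using c'(4) a'(2) by auto
    show "36 < a' + (a - a') + b + c' + 18 * j + 1" using assms(6,7) a'(1) c'(1) by linarith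
  qed
  moreover have "v = a' + (a - a') + b + c' + 18 * j + 1" using assms(6) a'(1) c'(1) by linarith
  ultimately show ?thesis using a'(1) c'(1) by simp
qed

lemma realizable_linear_6:
  assumes "6 \<le> a" "(b, c) \<in> {(18, 1), (17, 2), (20, 1), (19, 2), (18, 3), (17, 4)}"
    and "v = a + b + c + 1" "36 < v"
  shows "realizable v (triple a b c)"
proof -
  obtain k where "linear_path (int 6) (int b) (int c) k"
    using assms(2) linear_paths_6 by auto
  then have "realizable (6 + (a - 6) + b + c + 18 * 0 + 1) (triple (6 + (a - 6)) b (c + 18 * 0))"
    by (rule linear_path_realizable) (use assms in simp_all)
  then show ?thesis using assms(1,3) by simp
qed

lemma realizable_triple:
  assumes abc: "1 \<le> a" "1 \<le> b" "1 \<le> c" and v: "v = a + b + c + 1" "36 < v" "odd v" "\<not> 3 dvd v"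
  shows "realizable v (triple a b c)"
proof -
  \<comment> \<open>The cases belong to the cyclic table, the arcs, the paths from 0 and the
    zigzags, in this order.\<close>
  consider "a \<le> 5 \<and> b \<le> 3 * a + 1 \<or> 6 \<le> a \<and> a + b \<le> 16" | "a \<le> 5" "3 * a + 2 \<le> b"
    | "6 \<le> a" "17 \<le> a + b" "b \<le> 16" | "6 \<le> a" "17 \<le> b"
    by linarith
  then show ?thesis
  proof cases
    case 1
    then show ?thesis using abc v by (intro realizable_cyclic)
  next
    case 2
    have "v mod 6 = 1 \<or> v mod 6 = 5"
      using v(3,4) by presburger
    then show ?thesis
    proof
      assume "v mod 6 = 1"
      \<comment> \<open>Here v = 6 * q - s with s = -1 and arcs of q vertices; in the other class s
        = 1 and the arcs have q + 1 vertices.\<close>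
      then obtain q where "v = 6 * q + 1" using div_mult_mod_eq[of v 6] by (metis mult.commute)
      then show ?thesis
        using abc 2 v(1,2) by (intro realizable_arcs[of "-1" v q]) simp_all
    next
      assume "v mod 6 = 5"
      then obtain q where "v = 6 * q + 5" using div_mult_mod_eq[of v 6] by (metis mult.commute)
      then show ?thesis
        using abc 2 v(1,2) by (intro realizable_arcs[of 1 v "q + 1"]) simp_all
    qed
  next
    case 3
    then show ?thesis using abc v by (intro realizable_linear)
  next
    case 4
    show ?thesis
    proof (cases "even (b + c)")
      case True
      then show ?thesis using abc v 4 by (intro realizable_zigzag_even) simp_all
    next
      case False
      \<comment> \<open>As b is at least 17 and c at least 1, an odd sum below 23 is 19 or 21, which
        leaves six pairs.\<close>
      then have "23 \<le> b + c \<or> b + c = 19 \<or> b + c = 21"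
        using 4(2) abc(3) by presburger
      then consider "23 \<le> b + c"
        | "(b, c) \<in> {(18, 1), (17, 2), (20, 1), (19, 2), (18, 3), (17, 4)}"
        using 4(2) abc(3) by force
      then show ?thesis
      proof cases
        case 1
        then show ?thesis using False 4 v by (intro realizable_zigzag_odd)
      next
        case 2
        then show ?thesis using 4(1) v by (intro realizable_linear_6)
      qed
    qed
  qed
qed

theorem theorem5p3:
  fixes v :: nat and L :: "nat multiset"
  assumes "v > 0" and "v \<notin> {47, 49, 59}"
    and "size L = v - 1"
    and "strongly_admissible v L"
    and "set_mset L = {1, 6, 18}"
  shows "realizable v L"
proof -
  have "{1, 6, 18} \<subseteq> {1..v div 2}" and "gcd v 6 = 1"
    using assms(4,5) unfolding strongly_admissible_def by auto
  then have le: "36 \<le> v" by auto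
  have "\<not> 2 dvd v" "\<not> 3 dvd v"
    using \<open>gcd v 6 = 1\<close> gcd_greatest[of 2 v 6] gcd_greatest[of 3 v 6] by auto
  \<comment> \<open>The edges of length 18 only give 36 \<le> v; parity excludes 36 itself, where
    the two ways around the cycle between vertices at distance 18 would be equally long.\<close>
  then have v: "odd v" "\<not> 3 dvd v" "36 < v"
    using le by (auto simp: le_less)
  have L: "L = triple (count L 1) (count L 6) (count L 18)"
  proof (rule multiset_eqI)
    fix x
    show "count L x = count (triple (count L 1) (count L 6) (count L 18)) x"
      using assms(5) not_in_iff[of x L] by (cases "x \<in> {1, 6, 18}") auto
  qed
  have "1 \<le> count L 1" "1 \<le> count L 6" "1 \<le> count L 18"
    using assms(5) by (auto simp: Suc_le_eq)
  moreover have "v = count L 1 + count L 6 + count L 18 + 1"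
    using arg_cong[OF L, of size] assms(1,3) by simp
  ultimately show ?thesis
    using v L realizable_triple by metis
qed

end
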